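(* Let $r\ge 1$, $m_0\ge m_1\ge\cdots\ge m_r\ge 1$, $A_0=\sigma\sigma^*$ a real symmetric positive semidefinite $m_0\times m_0$ matrix, and $B_k$ a real $m_{k-1}\times m_k$ matrix of rank $m_k$ for $k=1,\dots,r$. Let $(P_t)_{t\ge0}$ be the semigroup on $\mathbb{R}^{m_0}\times\cdots\times\mathbb{R}^{m_r}$ of the diffusion $dX_1(t)=\sigma\,dB(t)$, $dX_{k+1}(t)=B_k^*X_k(t)\,dt$ $(1\le k\le r)$, with carré du champ $\Gamma$. Let $f\in C^1(\mathbb{R}^{m_0}\times\cdots\times\mathbb{R}^{m_r})$ be globally Lipschitz. Then for every $t\ge 0$ and every $x\in\mathbb{R}^{m_0}\times\cdots\times\mathbb{R}^{m_r}$, $$2\Gamma(P_tf)(x)\le P_t\left(\left\langle E(-t)AE^*(-t)\nabla f,\nabla f\right\rangle\right)(x),$$ and the following reverse inequality holds: $$\left\langle E(t)AE^*(t)\nabla P_tf(x),\nabla P_tf(x)\right\rangle\le 2P_t\left(\Gamma(f)\right)(x).$$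
   Context: Let $N=\sum_{k=0}^rm_k$, so $\mathbb{R}^{m_0}\times\cdots\times\mathbb{R}^{m_r}=\mathbb{R}^N$. In block form (block sizes $m_0,\dots,m_r$), $A=\begin{pmatrix}A_0&0\\0&0\end{pmatrix}$ is the $N\times N$ matrix with upper left block $A_0$ and zeros elsewhere, and $B$ is the $N\times N$ matrix whose $(k,k+1)$ block is $B_k$ for $1\le k\le r$ and all of whose other blocks are zero. $M^*$ denotes the transpose of a matrix $M$; $E(t)=\exp(-tB^* )$ for $t\in\mathbb{R}$ and $E^*(t)$ is its transpose. $\sigma$ is a constant $m_0\times m_0$ matrix with $\sigma\sigma^*=A_0$, $B(t)$ (with time argument, in the stochastic differential equation) is a standard Brownian motion in $\mathbb{R}^{m_0}$, and $X_i(t)$ is $\mathbb{R}^{m_{i-1}}$-valued. For $\mathbf{X}_t=(X_1(t),\dots,X_{r+1}(t))$, $P_tf(x)=\mathbb{E}^x[f(\mathbf{X}_t)]$, where $\mathbf{X}_0=x$. The generator is $\mathcal{L}=\frac12\mathrm{div}(AD)+\langle x,BD\rangle$, $D=(\partial_{x_1},\dots,\partial_{x_N})$. $\nabla f$ is the full gradient in $\mathbb{R}^N$ and $\langle\cdot,\cdot\rangle$ the Euclidean inner product. $\Gamma(f,g)=\frac12(\mathcal{L}(fg)-f\mathcal{L}g-g\mathcal{L}f)$ and $\Gamma(f)=\Gamma(f,f)$; explicitly $\Gamma(f)=\frac12\langle A\nabla f,\nabla f\rangle$, and this formula is used for all $C^1$ functions $f$. *)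

theory Defs
  imports "HOL-Probability.Probability" "Jordan_Normal_Form.DL_Rank"
begin

no_notation Finite_Cartesian_Product.vec_nth (infixl "$" 90)
notation Finite_Cartesian_Product.vec_nth (infixl "$h" 90)

text \<open>
  The block space with block sizes \<open>m 0, \<dots>, m r\<close> is modelled as \<open>real ^ 'n\<close> together with a
  labelling \<open>idx\<close> of the coordinates: \<open>idx p = (k, i)\<close> says that \<open>p\<close> is the \<open>i\<close>-th coordinate
  (counted from 0) of block \<open>k\<close>. Being a bijection, it forces \<open>CARD('n) = (\<Sum>k\<le>r. m k)\<close>. The small
  matrices \<open>\<sigma>\<close>, \<open>A0\<close>, \<open>B k\<close> have sizes varying with \<open>k\<close>, hence are matrices with explicit carriers.
\<close>

definition block_labelling :: "nat \<Rightarrow> (nat \<Rightarrow> nat) \<Rightarrow> ('n::finite \<Rightarrow> nat \<times> nat) \<Rightarrow> bool" where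
  "block_labelling r m idx \<longleftrightarrow> bij_betw idx UNIV (SIGMA k:{..r}. {..<m k})"

definition block ::
  "(nat \<Rightarrow> nat) \<Rightarrow> ('n::finite \<Rightarrow> nat \<times> nat) \<Rightarrow> nat \<Rightarrow> real ^ 'n \<Rightarrow> real Matrix.vec" where
  "block m idx k x = Matrix.vec (m k) (\<lambda>i. x $h inv_into UNIV idx (k, i))"

definition big_A :: "('n::finite \<Rightarrow> nat \<times> nat) \<Rightarrow> real mat \<Rightarrow> real ^ 'n ^ 'n" where
  "big_A idx A0 = (\<chi> p q. if fst (idx p) = 0 \<and> fst (idx q) = 0
     then A0 $$ (snd (idx p), snd (idx q)) else 0)"

text \<open>
  Blocks are numbered from 0 here, so the block of \<open>B\<close> in block row \<open>k - 1\<close> and block column \<open>k\<close>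
  is \<open>B k\<close>, of size \<open>m (k - 1)\<close> times \<open>m k\<close>, for \<open>1 \<le> k \<le> r\<close>.
\<close>

definition big_B :: "('n::finite \<Rightarrow> nat \<times> nat) \<Rightarrow> (nat \<Rightarrow> real mat) \<Rightarrow> real ^ 'n ^ 'n" where
  "big_B idx B = (\<chi> p q. if fst (idx q) = Suc (fst (idx p))
     then B (fst (idx q)) $$ (snd (idx p), snd (idx q)) else 0)"

text \<open>
  Square matrices \<open>real ^ 'n ^ 'n\<close> are not an instance of the class of normed algebras, so the
  library's \<open>exp\<close> does not apply to them.
\<close>

primrec mat_power :: "real ^ 'n ^ 'n \<Rightarrow> nat \<Rightarrow> real ^ 'n ^ 'n" where
  "mat_power M 0 = Finite_Cartesian_Product.mat 1"
| "mat_power M (Suc n) = M ** mat_power M n"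

definition mat_exp :: "real ^ 'n ^ 'n \<Rightarrow> real ^ 'n ^ 'n" where
  "mat_exp M = (\<Sum>n. (1 / fact n) *\<^sub>R mat_power M n)"

definition E_mat :: "('n::finite \<Rightarrow> nat \<times> nat) \<Rightarrow> (nat \<Rightarrow> real mat) \<Rightarrow> real \<Rightarrow> real ^ 'n ^ 'n" where
  "E_mat idx B t = mat_exp ((- t) *\<^sub>R Finite_Cartesian_Product.transpose (big_B idx B))"

definition grad :: "('a::real_inner \<Rightarrow> real) \<Rightarrow> 'a \<Rightarrow> 'a" where
  "grad f x = (THE D. GDERIV f x :> D)"

definition C1 :: "('a::real_inner \<Rightarrow> real) \<Rightarrow> bool" where
  "C1 f \<longleftrightarrow> (\<forall>x. f differentiable (at x)) \<and> continuous_on UNIV (grad f)"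

text \<open>
  The carre du champ of \<open>L = 1/2 div (A D) + \<langle>x, B D\<rangle>\<close>: for smooth \<open>f\<close>, \<open>1/2 (L (f\<^sup>2) - 2 f L f)\<close>
  equals this expression (the drift cancels), which also makes sense for \<open>f\<close> merely \<open>C\<^sup>1\<close>.
\<close>

definition Gamma :: "real ^ 'n ^ 'n \<Rightarrow> (real ^ 'n \<Rightarrow> real) \<Rightarrow> real ^ 'n \<Rightarrow> real" where
  "Gamma A f x = 1 / 2 * inner (A *v grad f x) (grad f x)"

text \<open>
  The last two clauses say that, for \<open>0 \<le> \<tau> 0 < \<dots> < \<tau> n\<close>, the increments over the intervals
  \<open>[\<tau> j, \<tau> (j + 1)]\<close> are independent with law \<open>N(0, (\<tau> (j + 1) - \<tau> j) I)\<close>; independence of the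
  components of one increment is part of this. \<open>normal_density\<close> takes the standard deviation.
\<close>

definition standard_brownian_motion ::
  "nat \<Rightarrow> 'w measure \<Rightarrow> (real \<Rightarrow> 'w \<Rightarrow> real Matrix.vec) \<Rightarrow> bool" where
  "standard_brownian_motion d M W \<longleftrightarrow>
     prob_space M \<and>
     (\<forall>t\<ge>0. \<forall>\<omega>\<in>space M. W t \<omega> \<in> carrier_vec d) \<and>
     (\<forall>t\<ge>0. \<forall>i<d. (\<lambda>\<omega>. W t \<omega> $ i) \<in> borel_measurable M) \<and>
     (AE \<omega> in M. W 0 \<omega> = 0\<^sub>v d) \<and>
     (AE \<omega> in M. \<forall>i<d. continuous_on {0..} (\<lambda>t. W t \<omega> $ i)) \<and>
     (\<forall>s t. 0 \<le> s \<longrightarrow> s < t \<longrightarrow> (\<forall>i<d.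
        distributed M lborel (\<lambda>\<omega>. W t \<omega> $ i - W s \<omega> $ i) (normal_density 0 (sqrt (t - s))))) \<and>
     (\<forall>n (\<tau> :: nat \<Rightarrow> real). 0 \<le> \<tau> 0 \<longrightarrow> (\<forall>j<n. \<tau> j < \<tau> (Suc j)) \<longrightarrow>
        prob_space.indep_vars M (\<lambda>_. borel)
          (\<lambda>(j, i) \<omega>. W (\<tau> (Suc j)) \<omega> $ i - W (\<tau> j) \<omega> $ i) ({..<n} \<times> {..<d}))"

text \<open>
  \<open>X\<close> solves \<open>dX\<^sub>1 = \<sigma> dW\<close>, \<open>dX\<^sub>k\<^sub>+\<^sub>1 = B\<^sub>k\<^sup>T X\<^sub>k dt\<close> for \<open>1 \<le> k \<le> r\<close>, started at \<open>x\<close>, in integrated form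
  (\<open>\<sigma>\<close> is constant, so the stochastic integral is \<open>\<sigma>\<close> applied to \<open>W t\<close>). The component \<open>X\<^sub>k\<^sub>+\<^sub>1\<close>
  is block \<open>k\<close>.
\<close>

definition diffusion_from ::
  "nat \<Rightarrow> (nat \<Rightarrow> nat) \<Rightarrow> real mat \<Rightarrow> (nat \<Rightarrow> real mat) \<Rightarrow> ('n::finite \<Rightarrow> nat \<times> nat) \<Rightarrow>
   'w measure \<Rightarrow> (real \<Rightarrow> 'w \<Rightarrow> real Matrix.vec) \<Rightarrow> real ^ 'n \<Rightarrow> (real \<Rightarrow> 'w \<Rightarrow> real ^ 'n) \<Rightarrow> bool" where
  "diffusion_from r m \<sigma> B idx M W x X \<longleftrightarrow>
     (\<forall>t\<ge>0. X t \<in> borel_measurable M) \<and>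
     (AE \<omega> in M. continuous_on {0..} (\<lambda>t. X t \<omega>)) \<and>
     (AE \<omega> in M. \<forall>t\<ge>0. block m idx 0 (X t \<omega>) = block m idx 0 x + \<sigma> *\<^sub>v W t \<omega>) \<and>
     (AE \<omega> in M. \<forall>t\<ge>0. \<forall>k\<in>{1..r}. \<forall>i<m k.
        block m idx k (X t \<omega>) $ i =
          block m idx k x $ i +
          integral {0..t} (\<lambda>s. (transpose_mat (B k) *\<^sub>v block m idx (k - 1) (X s \<omega>)) $ i))"

text \<open>\<open>X x\<close> is the process started at \<open>x\<close>, so that integration over \<open>M\<close> plays the role of \<open>E\<^sup>x\<close>.\<close>

definition Pt ::
  "'w measure \<Rightarrow> ('a \<Rightarrow> real \<Rightarrow> 'w \<Rightarrow> 'a) \<Rightarrow> real \<Rightarrow> ('a \<Rightarrow> real) \<Rightarrow> 'a \<Rightarrow> real" where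
  "Pt M X t f x = (\<integral>\<omega>. f (X x t \<omega>) \<partial>M)"

end

theory Submission
  imports Defs
begin

text \<open>
  Write \<open>C = B\<^sup>T\<close> for the drift matrix. The processes started at \<open>x\<close> and at \<open>y\<close> are driven by the same
  Brownian motion through a constant diffusion matrix, so the noise cancels in their difference,
  which solves the linear equation \<open>Z' = C Z\<close>. Hence, almost surely, \<open>X y t = X x t + E (y - x)\<close> with
  the deterministic matrix \<open>E = exp (t C) = E_mat (- t)\<close> (\<open>linear_equation_flow\<close>), and the semigroup
  is an average of deterministic shifts:
  \<open>P\<^sub>t f y\<close> is the expectation of \<open>f (X x t + E (y - x))\<close>.

  Since \<open>f\<close> is \<open>C\<^sup>1\<close> and Lipschitz, one may differentiate under the expectation
  (\<open>expectation_shift_has_derivative\<close>). This gives \<open>grad (P\<^sub>t f) x = E\<^sup>T G\<close>, where \<open>G\<close> is the expectation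
  of \<open>grad f (X x t)\<close>. Both inequalities are then Jensen's inequality for a positive semidefinite
  form (\<open>quadratic_form_expectation_le\<close>). The diffusion matrix factors as \<open>A = S S\<^sup>T\<close>, where \<open>S\<close>
  has \<open>\<sigma>\<close> as its upper left block and zeros elsewhere. In the forward bound the form is that of
  \<open>E A E\<^sup>T = (E S) (E S)\<^sup>T\<close>. In the reverse bound the factor \<open>E_mat t = exp (- t C)\<close> is the inverse of
  \<open>E\<close>, so it cancels the matrix in the gradient and leaves the form of \<open>A\<close>, evaluated at \<open>G\<close>.

  The remaining point is that \<open>f (X x t)\<close> is integrable, that is, that \<open>X x t\<close> has a first moment.
  Block 0 is Gaussian, and each further block is a time integral of the preceding one, so first
  moments that are bounded on \<open>[0, t]\<close> pass from block to block
  (\<open>triangular_system_moment_finite\<close>).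
\<close>

section \<open>The matrix exponential\<close>

lemma mat_power_entry_bound:
  fixes M :: "real ^ 'n::finite ^ 'n"
  assumes M: "\<And>p q. \<bar>M $h p $h q\<bar> \<le> c" and "c \<ge> 0"
  shows "\<bar>mat_power M n $h p $h q\<bar> \<le> (real CARD('n) * c) ^ n"
proof (induction n arbitrary: p)
  case 0
  then show ?case by (simp add: Finite_Cartesian_Product.mat_def)
next
  case (Suc n)
  have "\<bar>mat_power M (Suc n) $h p $h q\<bar> \<le> (\<Sum>k\<in>UNIV. \<bar>M $h p $h k\<bar> * \<bar>mat_power M n $h k $h q\<bar>)"
    by (simp add: matrix_matrix_mult_def flip: abs_mult)
  also have "\<dots> \<le> (\<Sum>k\<in>(UNIV::'n set). c * (real CARD('n) * c) ^ n)"
    by (intro sum_mono mult_mono M Suc.IH) (use \<open>c \<ge> 0\<close> in auto)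
  finally show ?case by (simp add: mult_ac)
qed

lemma mat_power_scale: "mat_power (s *\<^sub>R M) n = s ^ n *\<^sub>R mat_power M n"
  by (induction n)
    (simp_all add: matrix_matrix_mult_def Finite_Cartesian_Product.vec_eq_iff sum_distrib_left mult_ac)

lemma mat_power_commute: "M ** mat_power M n = mat_power M n ** M"
  by (induction n) (simp_all add: matrix_mul_assoc)

text \<open>
  The exponential is handled entry by entry: each entry of \<open>mat_exp (s *\<^sub>R M)\<close> is a real power
  series in \<open>s\<close> with infinite radius of convergence, so the library's termwise differentiation of
  power series applies.
\<close>

lemma summable_mat_exp_entry:
  fixes M :: "real ^ 'n::finite ^ 'n"
  shows "summable (\<lambda>n. mat_power M n $h p $h q / fact n * s ^ n)"
proof -
  define c where "c = (\<Sum>p\<in>UNIV. \<Sum>q\<in>UNIV. \<bar>M $h p $h q\<bar>)"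
  have c: "\<bar>M $h p $h q\<bar> \<le> c" for p q
  proof -
    have "\<bar>M $h p $h q\<bar> \<le> (\<Sum>q\<in>UNIV. \<bar>M $h p $h q\<bar>)"
      by (rule member_le_sum) auto
    also have "\<dots> \<le> c" unfolding c_def
      by (rule member_le_sum) (auto intro: sum_nonneg)
    finally show ?thesis .
  qed
  have "c \<ge> 0" by (auto simp: c_def intro!: sum_nonneg)
  show ?thesis
  proof (rule summable_comparison_test')
    show "summable (\<lambda>n. inverse (fact n) * (real CARD('n) * c * \<bar>s\<bar>) ^ n)"
      by (rule summable_exp)
    show "norm (mat_power M n $h p $h q / fact n * s ^ n)
        \<le> inverse (fact n) * (real CARD('n) * c * \<bar>s\<bar>) ^ n" for n
      using mult_right_mono[OF mat_power_entry_bound[OF c \<open>c \<ge> 0\<close>, of n p q], of "\<bar>s\<bar> ^ n / fact n"]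
      by (simp add: abs_mult power_abs power_mult_distrib field_simps)
  qed
qed

lemma mat_exp_entry:
  fixes M :: "real ^ 'n::finite ^ 'n"
  shows "mat_exp (s *\<^sub>R M) $h p $h q = (\<Sum>n. mat_power M n $h p $h q / fact n * s ^ n)"
proof -
  have "(\<lambda>n. (1 / fact n) *\<^sub>R mat_power (s *\<^sub>R M) n)
      sums (\<chi> p q. \<Sum>n. mat_power M n $h p $h q / fact n * s ^ n)"
    unfolding sums_def
    by (intro vec_tendstoI)
      (use summable_LIMSEQ[OF summable_mat_exp_entry[of M _ _ s]] in \<open>simp add: mat_power_scale mult_ac\<close>)
  then show ?thesis
    unfolding mat_exp_def by (simp add: sums_unique[symmetric])
qed

lemma mat_exp_entry_has_derivative:
  fixes M :: "real ^ 'n::finite ^ 'n"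
  shows "((\<lambda>s. mat_exp (s *\<^sub>R M) $h p $h q) has_real_derivative
     (M ** mat_exp (s *\<^sub>R M)) $h p $h q) (at s)"
proof -
  let ?c = "\<lambda>p n. mat_power M n $h p $h q / fact n"
  have d: "diffs (?c p) n = (\<Sum>k\<in>UNIV. M $h p $h k * ?c k n)" for n
    by (simp add: diffs_def matrix_matrix_mult_def sum_divide_distrib[symmetric] del: of_nat_Suc)
  have "(\<Sum>n. diffs (?c p) n * s ^ n) = (\<Sum>n. \<Sum>k\<in>UNIV. M $h p $h k * (?c k n * s ^ n))"
    by (simp add: d sum_distrib_left sum_distrib_right mult_ac)
  also have "\<dots> = (\<Sum>k\<in>UNIV. \<Sum>n. M $h p $h k * (?c k n * s ^ n))"
    by (rule suminf_sum) (intro summable_mult summable_mat_exp_entry)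
  also have "\<dots> = (\<Sum>k\<in>UNIV. M $h p $h k * (\<Sum>n. ?c k n * s ^ n))"
    by (simp only: suminf_mult[OF summable_mat_exp_entry])
  also have "\<dots> = (M ** mat_exp (s *\<^sub>R M)) $h p $h q"
    by (simp add: matrix_matrix_mult_def mat_exp_entry)
  finally have "(\<Sum>n. diffs (?c p) n * s ^ n) = (M ** mat_exp (s *\<^sub>R M)) $h p $h q" .
  then show ?thesis
    unfolding mat_exp_entry
    using termdiffs_strong_converges_everywhere[of "?c p" s] summable_mat_exp_entry by metis
qed

lemma mat_exp_commute:
  fixes M :: "real ^ 'n::finite ^ 'n"
  shows "M ** mat_exp (s *\<^sub>R M) = mat_exp (s *\<^sub>R M) ** M"
proof -
  let ?t = "\<lambda>p q n. mat_power M n $h p $h q / fact n * s ^ n"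
  have "(M ** mat_exp (s *\<^sub>R M)) $h p $h q = (mat_exp (s *\<^sub>R M) ** M) $h p $h q" for p q
  proof -
    have "(M ** mat_exp (s *\<^sub>R M)) $h p $h q = (\<Sum>n. \<Sum>k\<in>UNIV. M $h p $h k * ?t k q n)"
      by (simp only: matrix_matrix_mult_def mat_exp_entry vec_lambda_beta
          suminf_mult[OF summable_mat_exp_entry, symmetric]
          suminf_sum[OF summable_mult[OF summable_mat_exp_entry]])
    also have "(\<lambda>n. \<Sum>k\<in>UNIV. M $h p $h k * ?t k q n)
        = (\<lambda>n. (M ** mat_power M n) $h p $h q / fact n * s ^ n)"
      by (simp add: matrix_matrix_mult_def sum_distrib_left sum_distrib_right sum_divide_distrib mult_ac)
    also have "\<dots> = (\<lambda>n. \<Sum>k\<in>UNIV. ?t p k n * M $h k $h q)"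
      unfolding mat_power_commute
      by (simp add: matrix_matrix_mult_def sum_distrib_left sum_distrib_right sum_divide_distrib mult_ac)
    also have "suminf \<dots> = (mat_exp (s *\<^sub>R M) ** M) $h p $h q"
      by (simp only: matrix_matrix_mult_def mat_exp_entry vec_lambda_beta
          suminf_mult2[OF summable_mat_exp_entry]
          suminf_sum[OF summable_mult2[OF summable_mat_exp_entry]])
    finally show ?thesis .
  qed
  then show ?thesis by (simp add: Finite_Cartesian_Product.vec_eq_iff)
qed

lemma mat_exp_0: "mat_exp (0 :: real ^ 'n::finite ^ 'n) = Finite_Cartesian_Product.mat 1"
proof -
  have "mat_exp (0 *\<^sub>R (0 :: real ^ 'n ^ 'n)) $h p $h q
      = (Finite_Cartesian_Product.mat 1 :: real ^ 'n ^ 'n) $h p $h q" for p q :: 'n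
    unfolding mat_exp_entry
    by (simp only: powser_zero) simp
  then show ?thesis by (simp add: Finite_Cartesian_Product.vec_eq_iff)
qed

text \<open>
  Uniqueness for \<open>Z' = M Z\<close>: the product \<open>exp (- s M) Z s\<close> has derivative zero, so it keeps the
  value \<open>Z 0\<close> that it has at \<open>s = 0\<close>.
\<close>

lemma linear_ode_solution:
  fixes M :: "real ^ 'n::finite ^ 'n" and Z :: "real \<Rightarrow> real ^ 'n"
  assumes Z: "\<And>s p. s \<in> {0..t} \<Longrightarrow>
      ((\<lambda>s. Z s $h p) has_real_derivative (M *v Z s) $h p) (at s within {0..t})"
    and "t \<ge> 0"
  shows "mat_exp (- t *\<^sub>R M) *v Z t = Z 0"
proof -
  let ?e = "\<lambda>s. mat_exp (s *\<^sub>R (- M))"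
  have "(?e t *v Z t) $h p = (?e 0 *v Z 0) $h p" for p
  proof -
    have "((\<lambda>s. (?e s *v Z s) $h p) has_real_derivative 0) (at s within {0..t})"
      if s: "s \<in> {0..t}" for s
    proof -
      have e: "((\<lambda>s. ?e s $h p $h q) has_real_derivative (- M ** ?e s) $h p $h q)
          (at s within {0..t})" for q
        using mat_exp_entry_has_derivative by (rule has_field_derivative_at_within)
      have "((\<lambda>s. (?e s *v Z s) $h p) has_real_derivative
          (\<Sum>q\<in>UNIV. (- M ** ?e s) $h p $h q * Z s $h q + (M *v Z s) $h q * ?e s $h p $h q))
          (at s within {0..t})"
        unfolding matrix_vector_mult_def[of "?e _"] vec_lambda_beta
        by (intro DERIV_sum DERIV_mult' e Z s DERIV_mult)
      also have "(\<Sum>q\<in>UNIV. (- M ** ?e s) $h p $h q * Z s $h q + (M *v Z s) $h q * ?e s $h p $h q)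
          = ((- M ** ?e s) *v Z s + ?e s *v (M *v Z s)) $h p"
        by (simp add: matrix_vector_mult_def[of "- M ** _"] matrix_vector_mult_def[of "mat_exp _"]
            sum.distrib mult_ac)
      also have "(- M ** ?e s) *v Z s + ?e s *v (M *v Z s) = ?e s *v ((- M) *v Z s + M *v Z s)"
        by (simp only: mat_exp_commute[of "- M"] matrix_vector_mul_assoc[symmetric]
            matrix_vector_right_distrib)
      also have "(- M) *v Z s + M *v Z s = 0"
        by (simp flip: matrix_vector_mult_add_rdistrib)
      finally show ?thesis by simp
    qed
    then show ?thesis
      using has_field_derivative_zero_constant[of "{0..t}"] \<open>t \<ge> 0\<close> by force
  qed
  then have "?e t *v Z t = ?e 0 *v Z 0"
    by (simp add: Finite_Cartesian_Product.vec_eq_iff)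
  then show ?thesis by (simp add: mat_exp_0)
qed

text \<open>
  For \<open>t \<ge> 0\<close> this is the uniqueness statement applied to \<open>s \<mapsto> exp (s M) v\<close> for every \<open>v\<close>;
  the other sign follows on replacing \<open>M\<close> by \<open>- M\<close>.
\<close>

lemma mat_exp_inverse:
  fixes M :: "real ^ 'n::finite ^ 'n"
  shows "mat_exp (- t *\<^sub>R M) ** mat_exp (t *\<^sub>R M) = Finite_Cartesian_Product.mat 1"
proof -
  have nonneg: "mat_exp (- t *\<^sub>R M) ** mat_exp (t *\<^sub>R M) = Finite_Cartesian_Product.mat 1"
    if "t \<ge> 0" for t and M :: "real ^ 'n ^ 'n"
  proof -
    have "(mat_exp (- t *\<^sub>R M) ** mat_exp (t *\<^sub>R M)) *v v = v" for v
    proof -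
      have "((\<lambda>s. (mat_exp (s *\<^sub>R M) *v v) $h p) has_real_derivative
          (M *v (mat_exp (s *\<^sub>R M) *v v)) $h p) (at s within {0..t})" for s p
      proof -
        have "((\<lambda>s. \<Sum>q\<in>UNIV. mat_exp (s *\<^sub>R M) $h p $h q * v $h q) has_real_derivative
          (\<Sum>q\<in>UNIV. (M ** mat_exp (s *\<^sub>R M)) $h p $h q * v $h q)) (at s within {0..t})"
          by (intro DERIV_sum DERIV_cmult_right)
            (rule has_field_derivative_at_within[OF mat_exp_entry_has_derivative])
        then show ?thesis
          by (simp add: matrix_vector_mul_assoc) (simp add: matrix_vector_mult_def)
      qed
      then have "mat_exp (- t *\<^sub>R M) *v (mat_exp (t *\<^sub>R M) *v v) = mat_exp (0 *\<^sub>R M) *v v"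
        using \<open>t \<ge> 0\<close> by (intro linear_ode_solution)
      then show ?thesis by (simp add: matrix_vector_mul_assoc mat_exp_0)
    qed
    then show ?thesis by (simp add: matrix_eq)
  qed
  show ?thesis
  proof (cases "t \<ge> 0")
    case False
    then show ?thesis using nonneg[of "- t" "- M"] by simp
  qed (rule nonneg)
qed

section \<open>Gradients of Lipschitz functions and differentiation under the expectation\<close>

lemma grad_eqI:
  assumes "GDERIV f x :> D"
  shows "grad f x = D"
  unfolding grad_def
proof (rule the_equality)
  show "GDERIV f x :> D" by fact
  fix D' assume "GDERIV f x :> D'"
  then have "(\<lambda>h. inner h D') = (\<lambda>h. inner h D)"
    using assms has_derivative_unique unfolding gderiv_def by blast
  then show "D' = D" by (metis vector_eq_ldot)
qed

lemma GDERIV_grad: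
  fixes f :: "'a::euclidean_space \<Rightarrow> real"
  assumes "f differentiable (at x)"
  shows "GDERIV f x :> grad f x"
proof -
  obtain f' where f': "(f has_derivative f') (at x)"
    using assms by (auto simp: differentiable_def)
  then interpret bounded_linear f' by (rule has_derivative_bounded_linear)
  have "f' h = inner h (\<Sum>b\<in>Basis. f' b *\<^sub>R b)" for h
  proof -
    have "f' h = f' (\<Sum>b\<in>Basis. inner h b *\<^sub>R b)"
      by (simp add: euclidean_representation)
    also have "\<dots> = (\<Sum>b\<in>Basis. inner h b * f' b)"
      by (simp add: sum scaleR)
    finally show ?thesis by (simp add: inner_sum_right mult_ac)
  qed
  then have "f' = (\<lambda>h. inner h (\<Sum>b\<in>Basis. f' b *\<^sub>R b))" ..
  with f' have "GDERIV f x :> (\<Sum>b\<in>Basis. f' b *\<^sub>R b)"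
    unfolding gderiv_def by metis
  then show ?thesis by (simp only: grad_eqI)
qed

text \<open>
  The directional derivative of \<open>f\<close> along its own gradient is \<open>(norm (grad f x))\<^sup>2\<close>, and a difference
  quotient along that direction is at most \<open>L * norm (grad f x)\<close>.
\<close>

lemma norm_grad_le_lipschitz:
  fixes f :: "'a::euclidean_space \<Rightarrow> real"
  assumes f: "f differentiable (at x)" and L: "L-lipschitz_on UNIV f"
  shows "norm (grad f x) \<le> L"
proof -
  let ?D = "grad f x"
  have "(f has_derivative (\<lambda>h. inner h ?D)) (at (x + 0 *\<^sub>R ?D))"
    using GDERIV_grad[OF f] by (simp add: gderiv_def)
  moreover have "((\<lambda>s. x + s *\<^sub>R ?D) has_derivative (\<lambda>s. s *\<^sub>R ?D)) (at 0)"
    by (auto intro!: derivative_eq_intros)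
  ultimately have "((\<lambda>s. f (x + s *\<^sub>R ?D)) has_derivative (\<lambda>s. inner (s *\<^sub>R ?D) ?D)) (at 0)"
    by (rule has_derivative_compose[rotated])
  then have "DERIV (\<lambda>s. f (x + s *\<^sub>R ?D)) 0 :> inner ?D ?D"
    by (simp add: has_field_derivative_def mult_commute_abs)
  then have lim: "((\<lambda>s. (f (x + s *\<^sub>R ?D) - f x) / s) \<longlongrightarrow> inner ?D ?D) (at 0)"
    by (simp add: DERIV_def)
  have "(f (x + s *\<^sub>R ?D) - f x) / s \<le> L * norm ?D" if "s \<noteq> 0" for s
  proof -
    have "\<bar>f (x + s *\<^sub>R ?D) - f x\<bar> \<le> L * (\<bar>s\<bar> * norm ?D)"
      using lipschitz_onD[OF L, of "x + s *\<^sub>R ?D" x] by (simp add: dist_norm)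
    then have "\<bar>(f (x + s *\<^sub>R ?D) - f x) / s\<bar> \<le> L * norm ?D"
      using that by (simp add: field_simps)
    then show ?thesis by linarith
  qed
  then have "inner ?D ?D \<le> L * norm ?D"
    by (intro tendsto_upperbound[OF lim]) (auto simp: eventually_at_filter)
  moreover have "L \<ge> 0" using L by (rule lipschitz_on_nonneg)
  ultimately show ?thesis
    by (cases "?D = 0") (auto simp: power2_norm_eq_inner[symmetric] power2_eq_square)
qed

lemma C1_lipschitz_grad:
  fixes f :: "'a::euclidean_space \<Rightarrow> real"
  assumes "C1 f" "L-lipschitz_on UNIV f"
  shows "GDERIV f x :> grad f x" "norm (grad f x) \<le> L" "grad f \<in> borel_measurable borel"
    "f \<in> borel_measurable borel"
proof -
  have d: "f differentiable (at x)" and c: "continuous_on UNIV (grad f)"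
    using assms(1) by (simp_all add: C1_def)
  show "GDERIV f x :> grad f x" by (rule GDERIV_grad[OF d])
  show "norm (grad f x) \<le> L" by (rule norm_grad_le_lipschitz[OF d assms(2)])
  show "grad f \<in> borel_measurable borel" by (rule borel_measurable_continuous_onI[OF c])
  show "f \<in> borel_measurable borel"
    by (rule borel_measurable_continuous_onI[OF lipschitz_on_continuous_on[OF assms(2)]])
qed

lemma (in prob_space) integrable_lipschitz_shift:
  fixes Y :: "'a \<Rightarrow> 'b::euclidean_space" and f :: "'b \<Rightarrow> real"
  assumes Y: "Y \<in> borel_measurable M" and f: "integrable M (\<lambda>\<omega>. f (Y \<omega>))"
    and L: "L-lipschitz_on UNIV f"
  shows "integrable M (\<lambda>\<omega>. f (Y \<omega> + v))"
proof (rule Bochner_Integration.integrable_bound)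
  show "integrable M (\<lambda>\<omega>. \<bar>f (Y \<omega>)\<bar> + L * norm v)"
    using f by simp
  have "f \<in> borel_measurable borel"
    by (rule borel_measurable_continuous_onI[OF lipschitz_on_continuous_on[OF L]])
  then show "(\<lambda>\<omega>. f (Y \<omega> + v)) \<in> borel_measurable M" using Y by measurable
  have "\<bar>f (Y \<omega> + v) - f (Y \<omega>)\<bar> \<le> L * norm v" for \<omega>
    using lipschitz_onD[OF L, of "Y \<omega> + v" "Y \<omega>"] by (simp add: dist_norm)
  moreover have "L * norm v \<ge> 0" using lipschitz_on_nonneg[OF L] by simp
  ultimately show "AE \<omega> in M. norm (f (Y \<omega> + v)) \<le> norm (\<bar>f (Y \<omega>)\<bar> + L * norm v)"
    by (intro AE_I2) (smt (verit) real_norm_def)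
qed

text \<open>
  Dominated convergence: the remainder of the first-order expansion of \<open>f\<close> at \<open>Y \<omega>\<close>, divided by
  \<open>norm (y - x)\<close>, tends to zero for every \<open>\<omega>\<close>, and the Lipschitz bound on \<open>f\<close> and on its gradient
  makes it bounded uniformly in \<open>y\<close> and \<open>\<omega>\<close>.
\<close>

lemma (in prob_space) expectation_shift_has_derivative:
  fixes Y :: "'a \<Rightarrow> 'b::euclidean_space" and f :: "'b \<Rightarrow> real"
    and K :: "'c::real_normed_vector \<Rightarrow> 'b"
  assumes Y: "Y \<in> borel_measurable M" and f: "integrable M (\<lambda>\<omega>. f (Y \<omega>))"
    and C1: "C1 f" and L: "L-lipschitz_on UNIV f" and K: "bounded_linear K"
  shows "((\<lambda>y. \<integral>\<omega>. f (Y \<omega> + K (y - x)) \<partial>M) has_derivative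
     (\<lambda>h. inner (K h) (\<integral>\<omega>. grad f (Y \<omega>) \<partial>M))) (at x)"
proof -
  interpret K: bounded_linear K by fact
  note C = C1_lipschitz_grad[OF C1 L]
  note [measurable] = Y C(3,4)
  have "L \<ge> 0" using L by (rule lipschitz_on_nonneg)
  have int_grad: "integrable M (\<lambda>\<omega>. grad f (Y \<omega>))"
    by (rule integrable_const_bound[of _ L]) (use C(2) in auto)
  have int_shift: "integrable M (\<lambda>\<omega>. f (Y \<omega> + v))" for v
    by (rule integrable_lipschitz_shift[OF Y f L])
  \<comment> \<open>the normalised remainder of the first-order expansion at a sample point\<close>
  define q where "q y \<omega> =
    norm (f (Y \<omega> + K (y - x)) - f (Y \<omega>) - inner (K (y - x)) (grad f (Y \<omega>))) / norm (y - x)"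
    for y \<omega>
  have q_lim: "((\<lambda>y. q y \<omega>) \<longlongrightarrow> 0) (at x)" for \<omega>
  proof -
    have "((\<lambda>y. Y \<omega> + K (y - x)) has_derivative K) (at x)"
      by (auto intro!: derivative_eq_intros K.has_derivative)
    moreover have "(f has_derivative (\<lambda>h. inner h (grad f (Y \<omega>)))) (at (Y \<omega> + K (x - x)))"
      using C(1)[of "Y \<omega>"] by (simp add: gderiv_def K.zero)
    ultimately have "((\<lambda>y. f (Y \<omega> + K (y - x))) has_derivative
        (\<lambda>h. inner (K h) (grad f (Y \<omega>)))) (at x)"
      by (rule has_derivative_compose)
    then show ?thesis by (simp add: has_derivative_iff_norm q_def K.zero)
  qed
  obtain k where k: "\<And>h. norm (K h) \<le> norm h * k" and "k \<ge> 0"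
    using K.nonneg_bounded by blast
  have q_bound: "q y \<omega> \<le> 2 * L * k" for y \<omega>
  proof (cases "y = x")
    case False
    let ?h = "K (y - x)"
    have "\<bar>f (Y \<omega> + ?h) - f (Y \<omega>)\<bar> \<le> L * norm ?h"
      using lipschitz_onD[OF L, of "Y \<omega> + ?h" "Y \<omega>"] by (simp add: dist_norm)
    moreover have "\<bar>inner ?h (grad f (Y \<omega>))\<bar> \<le> norm ?h * L"
      using Cauchy_Schwarz_ineq2[of ?h "grad f (Y \<omega>)"] mult_left_mono[OF C(2)[of "Y \<omega>"], of "norm ?h"]
      by simp
    moreover have "L * norm ?h \<le> L * (norm (y - x) * k)"
      using k \<open>L \<ge> 0\<close> by (intro mult_left_mono)
    ultimately have "norm (f (Y \<omega> + ?h) - f (Y \<omega>) - inner ?h (grad f (Y \<omega>))) \<le> 2 * L * k * norm (y - x)"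
      by (simp add: mult_ac)
    then show ?thesis using False by (simp add: q_def divide_le_eq)
  qed (use \<open>L \<ge> 0\<close> \<open>k \<ge> 0\<close> in \<open>simp add: q_def\<close>)
  have q_nonneg: "q y \<omega> \<ge> 0" for y \<omega> by (simp add: q_def)
  have q_meas: "q y \<in> borel_measurable M" for y unfolding q_def by measurable
  have q_int: "integrable M (q y)" for y
    by (rule integrable_const_bound[of _ "2 * L * k"]) (use q_meas q_bound q_nonneg in auto)
  have Eq_lim: "((\<lambda>y. \<integral>\<omega>. q y \<omega> \<partial>M) \<longlongrightarrow> 0) (at x)"
    unfolding tendsto_at_iff_sequentially comp_def
  proof (intro allI impI)
    fix y :: "nat \<Rightarrow> 'c" assume y: "\<forall>i. y i \<in> UNIV - {x}" "y \<longlonglongrightarrow> x"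
    have "(\<lambda>i. \<integral>\<omega>. q (y i) \<omega> \<partial>M) \<longlonglongrightarrow> (\<integral>\<omega>. 0 \<partial>M)"
    proof (rule integral_dominated_convergence)
      show "integrable M (\<lambda>_. 2 * L * k)" by simp
      show "AE \<omega> in M. (\<lambda>i. q (y i) \<omega>) \<longlonglongrightarrow> 0"
        using q_lim y unfolding tendsto_at_iff_sequentially comp_def by blast
    qed (use q_meas q_bound q_nonneg in auto)
    then show "(\<lambda>i. \<integral>\<omega>. q (y i) \<omega> \<partial>M) \<longlonglongrightarrow> 0" by simp
  qed
  show ?thesis
    unfolding has_derivative_iff_norm
  proof (intro conjI)
    show "bounded_linear (\<lambda>h. inner (K h) (\<integral>\<omega>. grad f (Y \<omega>) \<partial>M))"
      by (intro bounded_linear_inner_left_comp K)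
    show "((\<lambda>y. norm ((\<integral>\<omega>. f (Y \<omega> + K (y - x)) \<partial>M) - (\<integral>\<omega>. f (Y \<omega> + K (x - x)) \<partial>M)
        - inner (K (y - x)) (\<integral>\<omega>. grad f (Y \<omega>) \<partial>M)) / norm (y - x)) \<longlongrightarrow> 0) (at x)"
    proof (rule tendsto_sandwich[OF _ _ tendsto_const Eq_lim])
      have "norm ((\<integral>\<omega>. f (Y \<omega> + K (y - x)) \<partial>M) - (\<integral>\<omega>. f (Y \<omega> + K (x - x)) \<partial>M)
        - inner (K (y - x)) (\<integral>\<omega>. grad f (Y \<omega>) \<partial>M)) / norm (y - x) \<le> (\<integral>\<omega>. q y \<omega> \<partial>M)" for y
      proof -
        have "(\<integral>\<omega>. f (Y \<omega> + K (y - x)) \<partial>M) - (\<integral>\<omega>. f (Y \<omega> + K (x - x)) \<partial>M)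
            - inner (K (y - x)) (\<integral>\<omega>. grad f (Y \<omega>) \<partial>M)
          = (\<integral>\<omega>. f (Y \<omega> + K (y - x)) - f (Y \<omega>) - inner (K (y - x)) (grad f (Y \<omega>)) \<partial>M)"
          using int_shift f int_grad by (simp add: K.zero)
        also have "norm \<dots> \<le> (\<integral>\<omega>. norm (f (Y \<omega> + K (y - x)) - f (Y \<omega>)
            - inner (K (y - x)) (grad f (Y \<omega>))) \<partial>M)"
          by (rule integral_norm_bound)
        finally show ?thesis
          by (simp add: q_def divide_right_mono)
      qed
      then show "\<forall>\<^sub>F y in at x. norm ((\<integral>\<omega>. f (Y \<omega> + K (y - x)) \<partial>M) - (\<integral>\<omega>. f (Y \<omega> + K (x - x)) \<partial>M)
        - inner (K (y - x)) (\<integral>\<omega>. grad f (Y \<omega>) \<partial>M)) / norm (y - x) \<le> (\<integral>\<omega>. q y \<omega> \<partial>M)"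
        by simp
    qed simp
  qed
qed

lemma (in prob_space) integrable_lipschitz_compose:
  fixes Y :: "'a \<Rightarrow> 'b::euclidean_space" and f :: "'b \<Rightarrow> real"
  assumes Y: "integrable M Y" and L: "L-lipschitz_on UNIV f"
  shows "integrable M (\<lambda>\<omega>. f (Y \<omega>))"
proof (rule Bochner_Integration.integrable_bound)
  show "integrable M (\<lambda>\<omega>. \<bar>f 0\<bar> + L * norm (Y \<omega>))"
    using Y by simp
  show "(\<lambda>\<omega>. f (Y \<omega>)) \<in> borel_measurable M"
    by (rule measurable_compose[OF borel_measurable_integrable[OF Y]
          borel_measurable_continuous_onI[OF lipschitz_on_continuous_on[OF L]]])
  have "\<bar>f (Y \<omega>)\<bar> \<le> \<bar>f 0\<bar> + L * norm (Y \<omega>)" for \<omega>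
    using lipschitz_onD[OF L, of "Y \<omega>" 0] by (simp add: dist_norm)
  then show "AE \<omega> in M. norm (f (Y \<omega>)) \<le> norm (\<bar>f 0\<bar> + L * norm (Y \<omega>))"
    by (intro AE_I2) (smt (verit) real_norm_def)
qed

section \<open>Quadratic forms of expectations\<close>

lemma quadratic_form_congruence:
  fixes E A :: "real ^ 'n::finite ^ 'n"
  shows "inner ((E ** A ** Finite_Cartesian_Product.transpose E) *v v) v
    = inner (A *v (Finite_Cartesian_Product.transpose E *v v)) (Finite_Cartesian_Product.transpose E *v v)"
  by (simp add: matrix_vector_mul_assoc[symmetric] dot_lmul_matrix[symmetric] inner_commute)

lemma quadratic_form_factor:
  fixes R :: "real ^ 'm::finite ^ 'n::finite"
  shows "inner ((R ** Finite_Cartesian_Product.transpose R) *v v) v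
    = (norm (Finite_Cartesian_Product.transpose R *v v))\<^sup>2"
  by (simp add: power2_norm_eq_inner dot_lmul_matrix[symmetric] matrix_vector_mul_assoc[symmetric]
      inner_commute)

text \<open>
  Jensen's inequality for the squared norm; after the triangle inequality for the integral it is the
  nonnegativity of the variance of \<open>norm u\<close>.
\<close>

lemma (in prob_space) norm_expectation_power2_le:
  fixes u :: "'a \<Rightarrow> 'b::euclidean_space"
  assumes u: "u \<in> borel_measurable M" "\<And>\<omega>. norm (u \<omega>) \<le> c"
  shows "(norm (\<integral>\<omega>. u \<omega> \<partial>M))\<^sup>2 \<le> (\<integral>\<omega>. (norm (u \<omega>))\<^sup>2 \<partial>M)"
proof -
  note [measurable] = u(1)
  have int: "integrable M (\<lambda>\<omega>. norm (u \<omega>))"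
    by (rule integrable_const_bound[of _ c]) (use u in auto)
  have "norm ((norm (u \<omega>))\<^sup>2) \<le> c\<^sup>2" for \<omega>
    using power_mono[OF u(2)[of \<omega>], of 2] by simp
  then have int2: "integrable M (\<lambda>\<omega>. (norm (u \<omega>))\<^sup>2)"
    by (intro integrable_const_bound[of _ "c\<^sup>2"] AE_I2) measurable
  have "(norm (\<integral>\<omega>. u \<omega> \<partial>M))\<^sup>2 \<le> (\<integral>\<omega>. norm (u \<omega>) \<partial>M)\<^sup>2"
    by (intro power_mono integral_norm_bound) simp
  also have "\<dots> \<le> (\<integral>\<omega>. (norm (u \<omega>))\<^sup>2 \<partial>M)"
    using variance_eq[OF int int2] variance_positive[of "\<lambda>\<omega>. norm (u \<omega>)"] by simp
  finally show ?thesis .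
qed

text \<open>
  Jensen's inequality for a positive semidefinite form. The factorisation \<open>Q = R R\<^sup>T\<close> turns the form
  into the squared norm of \<open>R\<^sup>T v\<close>, and the linear map \<open>R\<^sup>T\<close> commutes with the expectation.
\<close>

lemma (in prob_space) quadratic_form_expectation_le:
  fixes u :: "'a \<Rightarrow> real ^ 'n::finite" and R :: "real ^ 'm::finite ^ 'n"
  assumes u: "u \<in> borel_measurable M" "\<And>\<omega>. norm (u \<omega>) \<le> c"
    and Q: "Q = R ** Finite_Cartesian_Product.transpose R"
  shows "inner (Q *v (\<integral>\<omega>. u \<omega> \<partial>M)) (\<integral>\<omega>. u \<omega> \<partial>M) \<le> (\<integral>\<omega>. inner (Q *v u \<omega>) (u \<omega>) \<partial>M)"
proof -
  let ?T = "(*v) (Finite_Cartesian_Product.transpose R)"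
  interpret T: bounded_linear ?T by simp
  obtain k where k: "\<And>h. norm (?T h) \<le> norm h * k" "k \<ge> 0"
    using T.nonneg_bounded by blast
  have "integrable M u"
    by (rule integrable_const_bound[of _ c]) (use u in auto)
  then have "?T (\<integral>\<omega>. u \<omega> \<partial>M) = (\<integral>\<omega>. ?T (u \<omega>) \<partial>M)"
    using integral_bounded_linear[OF T.bounded_linear_axioms] by metis
  moreover have "norm (?T (u \<omega>)) \<le> c * k" for \<omega>
    using k(1)[of "u \<omega>"] mult_right_mono[OF u(2)[of \<omega>] k(2)] by linarith
  moreover have "(\<lambda>\<omega>. ?T (u \<omega>)) \<in> borel_measurable M"
    using u(1) borel_measurable_continuous_onI[OF T.continuous_on[OF continuous_on_id]]
    by (rule measurable_compose)
  ultimately show ?thesis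
    unfolding Q quadratic_form_factor using norm_expectation_power2_le by metis
qed

section \<open>The system in block form and its flow\<close>

text \<open>
  The noise cancels in the difference of two solutions driven by the same path \<open>n\<close>, which therefore
  solves \<open>Z' = C Z\<close> with \<open>Z 0 = y - x\<close>.
\<close>

lemma linear_equation_flow:
  fixes C :: "real ^ 'n::finite ^ 'n" and X Y :: "real \<Rightarrow> real ^ 'n" and n :: "real \<Rightarrow> real ^ 'n"
  assumes cX: "continuous_on {0..} X" and cY: "continuous_on {0..} Y"
    and X: "\<And>s p. s \<ge> 0 \<Longrightarrow> X s $h p = x $h p + n s $h p + integral {0..s} (\<lambda>u. (C *v X u) $h p)"
    and Y: "\<And>s p. s \<ge> 0 \<Longrightarrow> Y s $h p = y $h p + n s $h p + integral {0..s} (\<lambda>u. (C *v Y u) $h p)"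
    and "t \<ge> 0"
  shows "Y t = X t + mat_exp (t *\<^sub>R C) *v (y - x)"
proof -
  define Z where "Z s = Y s - X s" for s
  have cont: "continuous_on {0..s} (\<lambda>u. (C *v V u) $h p)" if "continuous_on {0..} V"
    for s p and V :: "real \<Rightarrow> real ^ 'n"
    by (intro continuous_on_component bounded_linear.continuous_on[OF matrix_vector_mul_bounded_linear]
        continuous_on_subset[OF that]) simp
  have cZ: "continuous_on {0..} Z"
    unfolding Z_def using cX cY by (intro continuous_intros)
  have Z: "Z s $h p = (y - x) $h p + integral {0..s} (\<lambda>u. (C *v Z u) $h p)" if "s \<ge> 0" for s p
  proof -
    have "integral {0..s} (\<lambda>u. (C *v Z u) $h p)
        = integral {0..s} (\<lambda>u. (C *v Y u) $h p) - integral {0..s} (\<lambda>u. (C *v X u) $h p)"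
      unfolding Z_def matrix_vector_mult_diff_distrib vector_minus_component
      by (intro Henstock_Kurzweil_Integration.integral_diff integrable_continuous_interval
          cont[OF cX] cont[OF cY])
    then show ?thesis by (simp add: X[OF that] Y[OF that] Z_def)
  qed
  have "((\<lambda>s. Z s $h p) has_real_derivative (C *v Z s) $h p) (at s within {0..t})"
    if s: "s \<in> {0..t}" for s p
  proof -
    have "((\<lambda>s. (y - x) $h p + integral {0..s} (\<lambda>u. (C *v Z u) $h p)) has_real_derivative
        0 + (C *v Z s) $h p) (at s within {0..t})"
      by (intro DERIV_add DERIV_const integral_has_real_derivative[OF cont[OF cZ] s])
    then have "((\<lambda>s. (y - x) $h p + integral {0..s} (\<lambda>u. (C *v Z u) $h p)) has_real_derivative
        (C *v Z s) $h p) (at s within {0..t})"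
      by simp
    then show ?thesis
      by (rule has_field_derivative_transform_within[where d = 1]) (use s Z in auto)
  qed
  then have "mat_exp (- t *\<^sub>R C) *v Z t = Z 0"
    using \<open>t \<ge> 0\<close> by (rule linear_ode_solution)
  moreover have "Z 0 = y - x"
    by (simp add: Finite_Cartesian_Product.vec_eq_iff Z)
  moreover have "mat_exp (t *\<^sub>R C) *v (mat_exp (- t *\<^sub>R C) *v Z t) = Z t"
    using mat_exp_inverse[of "- t" C] by (simp add: matrix_vector_mul_assoc)
  ultimately show ?thesis by (simp add: Z_def)
qed

lemma block_coordinate:
  assumes "block_labelling r m idx"
  shows "fst (idx p) \<le> r" "snd (idx p) < m (fst (idx p))"
    "block m idx (fst (idx p)) x $ snd (idx p) = x $h p"
proof -
  have bij: "bij_betw idx UNIV (SIGMA k:{..r}. {..<m k})"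
    using assms by (simp add: block_labelling_def)
  then have "idx p \<in> (SIGMA k:{..r}. {..<m k})" by (auto simp: bij_betw_def)
  then show "fst (idx p) \<le> r" "snd (idx p) < m (fst (idx p))" by auto
  then show "block m idx (fst (idx p)) x $ snd (idx p) = x $h p"
    using bij by (simp add: block_def bij_betw_def inv_f_f)
qed

lemma sum_block:
  assumes "block_labelling r m idx" "k \<le> r"
  shows "(\<Sum>q\<in>UNIV. if fst (idx q) = k then g (snd (idx q)) q else (0::real))
    = (\<Sum>i<m k. g i (inv_into UNIV idx (k, i)))"
proof -
  have bij: "bij_betw idx UNIV (SIGMA k:{..r}. {..<m k})"
    using assms by (simp add: block_labelling_def)
  have inv: "idx (inv_into UNIV idx (k, i)) = (k, i)" if "i < m k" for i
    using bij_betw_inv_into_right[OF bij, of "(k, i)"] that \<open>k \<le> r\<close> by auto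
  have "(\<Sum>q\<in>UNIV. if fst (idx q) = k then g (snd (idx q)) q else 0)
      = (\<Sum>q\<in>{q. fst (idx q) = k}. g (snd (idx q)) q)"
    by (simp add: sum.If_cases)
  also have "\<dots> = (\<Sum>i<m k. g i (inv_into UNIV idx (k, i)))"
  proof (rule sum.reindex_bij_witness[of _ "\<lambda>i. inv_into UNIV idx (k, i)" "\<lambda>q. snd (idx q)"])
    fix q assume "q \<in> {q. fst (idx q) = k}"
    then have k: "(k, snd (idx q)) = idx q" by auto
    show q: "inv_into UNIV idx (k, snd (idx q)) = q"
      unfolding k using bij by (simp add: bij_betw_def inv_f_f)
    show "snd (idx q) \<in> {..<m k}"
      using block_coordinate(2)[OF assms(1), of q] k by (metis fst_conv lessThan_iff)
    show "g (snd (idx q)) (inv_into UNIV idx (k, snd (idx q))) = g (snd (idx q)) q"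
      by (simp only: q)
  qed (use inv in auto)
  finally show ?thesis .
qed

lemma transpose_big_B_block:
  assumes bl: "block_labelling r m idx"
    and B: "\<forall>k\<in>{1..r}. B k \<in> carrier_mat (m (k - 1)) (m k)"
    and k: "fst (idx p) \<noteq> 0"
  shows "(transpose_mat (B (fst (idx p))) *\<^sub>v block m idx (fst (idx p) - 1) y) $ snd (idx p)
    = (Finite_Cartesian_Product.transpose (big_B idx B) *v y) $h p"
proof -
  obtain k' where k': "fst (idx p) = Suc k'" using k by (cases "fst (idx p)") auto
  let ?i = "snd (idx p)"
  have le: "Suc k' \<le> r" and i: "?i < m (Suc k')"
    using block_coordinate(1,2)[OF bl, of p] k' by auto
  have Bk: "B (Suc k') \<in> carrier_mat (m k') (m (Suc k'))"
    using B le by (metis atLeastAtMost_iff diff_Suc_1 le_add1 plus_1_eq_Suc)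
  have "(Finite_Cartesian_Product.transpose (big_B idx B) *v y) $h p
      = (\<Sum>q\<in>UNIV. if fst (idx q) = k' then B (Suc k') $$ (snd (idx q), ?i) * y $h q else 0)"
    using k' by (auto simp: matrix_vector_mult_def big_B_def Finite_Cartesian_Product.transpose_def
        intro!: sum.cong)
  also have "\<dots> = (\<Sum>j<m k'. B (Suc k') $$ (j, ?i) * y $h inv_into UNIV idx (k', j))"
    using le by (intro sum_block[OF bl]) simp
  also have "\<dots> = (transpose_mat (B (Suc k')) *\<^sub>v block m idx k' y) $ ?i"
    using Bk i by (simp add: scalar_prod_def atLeast0LessThan block_def)
  finally show ?thesis using k' by simp
qed

text \<open>
  The Brownian input, placed in the coordinates of block 0 and zero elsewhere, so that the equations
  of all blocks become one vector equation with the drift matrix \<open>B\<^sup>T\<close>.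
\<close>

definition noise ::
  "real mat \<Rightarrow> ('n::finite \<Rightarrow> nat \<times> nat) \<Rightarrow> (real \<Rightarrow> 'w \<Rightarrow> real Matrix.vec) \<Rightarrow> real \<Rightarrow> 'w \<Rightarrow> real ^ 'n"
where
  "noise \<sigma> idx W t \<omega> = (\<chi> p. if fst (idx p) = 0 then (\<sigma> *\<^sub>v W t \<omega>) $ snd (idx p) else 0)"

text \<open>
  In a coordinate of block 0 the corresponding row of \<open>B\<^sup>T\<close> vanishes, and in every other block the
  noise does, so one equation covers both clauses of the definition of the diffusion.
\<close>

lemma diffusion_path_equation:
  assumes bl: "block_labelling r m idx" and \<sigma>: "\<sigma> \<in> carrier_mat (m 0) (m 0)"
    and B: "\<forall>k\<in>{1..r}. B k \<in> carrier_mat (m (k - 1)) (m k)"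
    and X: "diffusion_from r m \<sigma> B idx M W x X"
  shows "AE \<omega> in M. continuous_on {0..} (\<lambda>t. X t \<omega>) \<and>
    (\<forall>t\<ge>0. \<forall>p. X t \<omega> $h p = x $h p + noise \<sigma> idx W t \<omega> $h p +
      integral {0..t} (\<lambda>s. (Finite_Cartesian_Product.transpose (big_B idx B) *v X s \<omega>) $h p))"
proof -
  note coord = block_coordinate[OF bl]
  have "AE \<omega> in M. continuous_on {0..} (\<lambda>t. X t \<omega>)"
    and "AE \<omega> in M. \<forall>t\<ge>0. block m idx 0 (X t \<omega>) = block m idx 0 x + \<sigma> *\<^sub>v W t \<omega>"
    and "AE \<omega> in M. \<forall>t\<ge>0. \<forall>k\<in>{1..r}. \<forall>i<m k. block m idx k (X t \<omega>) $ i = block m idx k x $ i +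
      integral {0..t} (\<lambda>s. (transpose_mat (B k) *\<^sub>v block m idx (k - 1) (X s \<omega>)) $ i)"
    using X by (auto simp: diffusion_from_def)
  then show ?thesis
  proof eventually_elim
    case (elim \<omega>)
    have "X t \<omega> $h p = x $h p + noise \<sigma> idx W t \<omega> $h p +
      integral {0..t} (\<lambda>s. (Finite_Cartesian_Product.transpose (big_B idx B) *v X s \<omega>) $h p)"
      if "t \<ge> 0" for t p
    proof (cases "fst (idx p) = 0")
      case True
      have "(Finite_Cartesian_Product.transpose (big_B idx B) *v y) $h p = 0" for y
        using True by (simp add: matrix_vector_mult_def big_B_def Finite_Cartesian_Product.transpose_def)
      moreover have "block m idx 0 (X t \<omega>) $ snd (idx p)
          = block m idx 0 x $ snd (idx p) + (\<sigma> *\<^sub>v W t \<omega>) $ snd (idx p)"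
        using elim(2) that coord(2)[of p] \<sigma> True by simp
      ultimately show ?thesis
        using coord(3)[of p] True by (simp add: noise_def)
    next
      case False
      then have "block m idx (fst (idx p)) (X t \<omega>) $ snd (idx p) = block m idx (fst (idx p)) x $ snd (idx p) +
        integral {0..t} (\<lambda>s. (transpose_mat (B (fst (idx p))) *\<^sub>v
          block m idx (fst (idx p) - 1) (X s \<omega>)) $ snd (idx p))"
        using elim(3) that coord(1,2)[of p] by simp
      then show ?thesis
        unfolding transpose_big_B_block[OF bl B False] coord(3) using False by (simp add: noise_def)
    qed
    then show ?case using elim(1) by blast
  qed
qed

lemma big_A_factor:
  assumes bl: "block_labelling r m idx" and \<sigma>: "\<sigma> \<in> carrier_mat (m 0) (m 0)"
  shows "big_A idx (\<sigma> * transpose_mat \<sigma>)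
    = big_A idx \<sigma> ** Finite_Cartesian_Product.transpose (big_A idx \<sigma>)"
proof -
  have "(big_A idx \<sigma> ** Finite_Cartesian_Product.transpose (big_A idx \<sigma>)) $h p $h q
      = big_A idx (\<sigma> * transpose_mat \<sigma>) $h p $h q" for p q
  proof (cases "fst (idx p) = 0 \<and> fst (idx q) = 0")
    case True
    then have i: "snd (idx p) < m 0" "snd (idx q) < m 0"
      using block_coordinate(2)[OF bl, of p] block_coordinate(2)[OF bl, of q] by auto
    have "(big_A idx \<sigma> ** Finite_Cartesian_Product.transpose (big_A idx \<sigma>)) $h p $h q
        = (\<Sum>l\<in>UNIV. if fst (idx l) = 0
            then \<sigma> $$ (snd (idx p), snd (idx l)) * \<sigma> $$ (snd (idx q), snd (idx l)) else 0)"
      using True by (auto simp: matrix_matrix_mult_def big_A_def Finite_Cartesian_Product.transpose_def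
          intro!: sum.cong)
    also have "\<dots> = (\<Sum>l<m 0. \<sigma> $$ (snd (idx p), l) * \<sigma> $$ (snd (idx q), l))"
      by (rule sum_block[OF bl]) simp
    also have "\<dots> = (\<sigma> * transpose_mat \<sigma>) $$ (snd (idx p), snd (idx q))"
      using i \<sigma> by (simp add: scalar_prod_def atLeast0LessThan)
    finally show ?thesis using True by (simp add: big_A_def)
  qed (auto simp: matrix_matrix_mult_def big_A_def Finite_Cartesian_Product.transpose_def)
  then show ?thesis by (simp add: Finite_Cartesian_Product.vec_eq_iff)
qed

section \<open>First moments of the diffusion\<close>

lemma riemann_sums_tendsto_integral:
  fixes y :: "real \<Rightarrow> real"
  assumes y: "continuous_on {0..t} y" and "t \<ge> 0"
  shows "(\<lambda>n. \<Sum>k<n. t / real n * y (real k * (t / real n))) \<longlonglongrightarrow> integral {0..t} y"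
proof (rule LIMSEQ_I)
  fix \<epsilon> :: real assume "\<epsilon> > 0"
  \<comment> \<open>the added 1 keeps the denominator positive when t = 0\<close>
  define e where "e = \<epsilon> / (t + 1)"
  have e: "e > 0" "e * t < \<epsilon>"
    using \<open>\<epsilon> > 0\<close> \<open>t \<ge> 0\<close> by (auto simp: e_def field_simps)
  have "uniformly_continuous_on {0..t} y"
    using y by (rule compact_uniformly_continuous) simp
  then obtain d where "d > 0"
    and d: "\<And>u v. u \<in> {0..t} \<Longrightarrow> v \<in> {0..t} \<Longrightarrow> dist v u < d \<Longrightarrow> dist (y v) (y u) < e"
    using e(1) unfolding uniformly_continuous_on_def by meson
  obtain N where N: "t / d < real N" using reals_Archimedean2 by blast
  show "\<exists>no. \<forall>n\<ge>no. norm ((\<Sum>k<n. t / real n * y (real k * (t / real n))) - integral {0..t} y) < \<epsilon>"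
  proof (intro exI allI impI)
    fix n assume n: "n \<ge> Suc N"
    define h where "h = t / real n"
    have h: "h \<ge> 0" "h < d" "real n * h = t"
    proof -
      show "h \<ge> 0" "real n * h = t" using \<open>t \<ge> 0\<close> n by (auto simp: h_def)
      have "t / d < real n" using N n by linarith
      then show "h < d" using \<open>d > 0\<close> n by (simp add: h_def field_simps)
    qed
    define I where "I k = {real k * h .. real (Suc k) * h}" for k
    have sub: "{0..real k * h} \<subseteq> {0..t}" if "k \<le> n" for k
      using mult_right_mono[of "real k" "real n" h] h that by auto
    have Isub: "I k \<subseteq> {0..t}" if "k < n" for k
      using sub[of "Suc k"] that h(1) by (auto simp: I_def)
    have split: "integral {0..real j * h} y = (\<Sum>k<j. integral (I k) y)" if "j \<le> n" for j
      using that
    proof (induction j)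
      case (Suc j)
      have "integral {0..real j * h} y + integral (I j) y = integral {0..real (Suc j) * h} y"
        unfolding I_def
        by (intro Henstock_Kurzweil_Integration.integral_combine integrable_continuous_interval
            continuous_on_subset[OF y] sub Suc.prems) (use h(1) in \<open>auto intro!: mult_right_mono\<close>)
      with Suc show ?case by simp
    qed simp
    have piece: "\<bar>h * y (real k * h) - integral (I k) y\<bar> \<le> e * h" if k: "k < n" for k
    proof -
      have cont: "continuous_on (I k) y" by (rule continuous_on_subset[OF y Isub[OF k]])
      have le: "real k * h \<le> real (Suc k) * h" using h(1) by (intro mult_right_mono) auto
      have "norm (integral (I k) (\<lambda>u. y u - y (real k * h))) \<le> e * (real (Suc k) * h - real k * h)"
        unfolding I_def
      proof (rule integral_bound[OF le])
        show "continuous_on {real k * h..real (Suc k) * h} (\<lambda>u. y u - y (real k * h))"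
          using cont unfolding I_def by (intro continuous_intros)
        fix u assume u: "u \<in> {real k * h..real (Suc k) * h}"
        have "dist u (real k * h) < d" using u h by (auto simp: dist_real_def algebra_simps)
        moreover have "u \<in> {0..t}" "real k * h \<in> {0..t}"
          using Isub[OF k] u le unfolding I_def by auto
        ultimately show "norm (y u - y (real k * h)) \<le> e"
          using d by (fastforce simp: dist_norm)
      qed
      also have "integral (I k) (\<lambda>u. y u - y (real k * h)) = integral (I k) y - h * y (real k * h)"
        using cont le unfolding I_def
        by (subst Henstock_Kurzweil_Integration.integral_diff)
          (auto intro: integrable_continuous_interval simp: algebra_simps)
      finally show ?thesis by (simp add: algebra_simps abs_minus_commute)
    qed
    have "(\<Sum>k<n. h * y (real k * h)) - integral {0..t} y
        = (\<Sum>k<n. h * y (real k * h) - integral (I k) y)"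
      using split[of n] h(3) by (simp add: sum_subtractf)
    also have "\<bar>\<dots>\<bar> \<le> (\<Sum>k<n. e * h)"
      by (intro order.trans[OF sum_abs] sum_mono piece) simp
    also have "\<dots> = e * t" using h(3) by (simp add: mult_ac)
    finally show "norm ((\<Sum>k<n. t / real n * y (real k * (t / real n))) - integral {0..t} y) < \<epsilon>"
      using e(2) by (simp add: h_def)
  qed
qed

text \<open>
  Measurability of \<open>Y\<close> is given at each fixed time only, not jointly in time and \<open>\<omega>\<close>, so the two
  integrals cannot simply be exchanged. Instead the time integral is, almost surely, a limit of
  Riemann sums; these are measurable and obey the bound, which passes to the limit by Fatou's lemma.
\<close>

lemma nn_integral_time_integral_le:
  fixes Y :: "real \<Rightarrow> 'w \<Rightarrow> real"
  assumes meas: "\<And>s. s \<in> {0..t} \<Longrightarrow> Y s \<in> borel_measurable M"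
    and cont: "AE \<omega> in M. continuous_on {0..t} (\<lambda>s. Y s \<omega>)"
    and c: "\<And>s. s \<in> {0..t} \<Longrightarrow> (\<integral>\<^sup>+\<omega>. ennreal \<bar>Y s \<omega>\<bar> \<partial>M) \<le> c"
    and "t \<ge> 0"
  shows "(\<integral>\<^sup>+\<omega>. ennreal \<bar>integral {0..t} (\<lambda>s. Y s \<omega>)\<bar> \<partial>M) \<le> ennreal t * c"
proof -
  let ?R = "\<lambda>n \<omega>. \<Sum>k<n. t / real n * Y (real k * (t / real n)) \<omega>"
  have node: "real k * (t / real n) \<in> {0..t}" if "k < n" for k n
    using that \<open>t \<ge> 0\<close> mult_right_mono[of "real k" "real n" t] by (auto simp: field_simps)
  have R_meas: "?R n \<in> borel_measurable M" for n
    by (intro borel_measurable_sum borel_measurable_times borel_measurable_const meas node) simp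
  have R_le: "(\<integral>\<^sup>+\<omega>. ennreal \<bar>?R n \<omega>\<bar> \<partial>M) \<le> ennreal t * c" for n
  proof -
    have "(\<integral>\<^sup>+\<omega>. ennreal \<bar>?R n \<omega>\<bar> \<partial>M)
        \<le> (\<integral>\<^sup>+\<omega>. (\<Sum>k<n. ennreal (t / real n) * ennreal \<bar>Y (real k * (t / real n)) \<omega>\<bar>) \<partial>M)"
    proof (rule nn_integral_mono)
      fix \<omega>
      have "\<bar>?R n \<omega>\<bar> \<le> (\<Sum>k<n. t / real n * \<bar>Y (real k * (t / real n)) \<omega>\<bar>)"
        using sum_abs[of "\<lambda>k. t / real n * Y (real k * (t / real n)) \<omega>" "{..<n}"] \<open>t \<ge> 0\<close>
        by (simp add: abs_mult)
      then show "ennreal \<bar>?R n \<omega>\<bar> \<le> (\<Sum>k<n. ennreal (t / real n) * ennreal \<bar>Y (real k * (t / real n)) \<omega>\<bar>)"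
        using \<open>t \<ge> 0\<close> by (simp add: ennreal_mult[symmetric] sum_ennreal ennreal_leI)
    qed
    also have "\<dots> = (\<Sum>k<n. ennreal (t / real n) * (\<integral>\<^sup>+\<omega>. ennreal \<bar>Y (real k * (t / real n)) \<omega>\<bar> \<partial>M))"
    proof (subst nn_integral_sum)
      fix k assume "k \<in> {..<n}"
      then have [measurable]: "Y (real k * (t / real n)) \<in> borel_measurable M"
        by (intro meas node) simp
      show "(\<lambda>\<omega>. ennreal (t / real n) * ennreal \<bar>Y (real k * (t / real n)) \<omega>\<bar>) \<in> borel_measurable M"
        by measurable
    next
      show "(\<Sum>k<n. \<integral>\<^sup>+\<omega>. ennreal (t / real n) * ennreal \<bar>Y (real k * (t / real n)) \<omega>\<bar> \<partial>M)
        = (\<Sum>k<n. ennreal (t / real n) * (\<integral>\<^sup>+\<omega>. ennreal \<bar>Y (real k * (t / real n)) \<omega>\<bar> \<partial>M))"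
      proof (intro sum.cong refl nn_integral_cmult)
        fix k assume "k \<in> {..<n}"
        then have [measurable]: "Y (real k * (t / real n)) \<in> borel_measurable M"
          by (intro meas node) simp
        show "(\<lambda>\<omega>. ennreal \<bar>Y (real k * (t / real n)) \<omega>\<bar>) \<in> borel_measurable M"
          by measurable
      qed
    qed
    also have "\<dots> \<le> (\<Sum>k<n. ennreal (t / real n) * c)"
      by (intro sum_mono mult_left_mono c node) auto
    also have "\<dots> = ennreal (real n) * ennreal (t / real n) * c"
      by (simp add: ennreal_of_nat_eq_real_of_nat mult.assoc)
    also have "\<dots> \<le> ennreal t * c"
      using \<open>t \<ge> 0\<close> by (intro mult_right_mono) (cases "n = 0"; simp flip: ennreal_mult)+
    finally show ?thesis .
  qed
  have "AE \<omega> in M. ennreal \<bar>integral {0..t} (\<lambda>s. Y s \<omega>)\<bar> = liminf (\<lambda>n. ennreal \<bar>?R n \<omega>\<bar>)"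
    using cont
  proof eventually_elim
    case (elim \<omega>)
    have "(\<lambda>n. ennreal \<bar>?R n \<omega>\<bar>) \<longlonglongrightarrow> ennreal \<bar>integral {0..t} (\<lambda>s. Y s \<omega>)\<bar>"
      by (intro tendsto_ennrealI tendsto_rabs riemann_sums_tendsto_integral elim \<open>t \<ge> 0\<close>)
    then show ?case by (rule lim_imp_Liminf[OF trivial_limit_sequentially, symmetric])
  qed
  then have "(\<integral>\<^sup>+\<omega>. ennreal \<bar>integral {0..t} (\<lambda>s. Y s \<omega>)\<bar> \<partial>M)
      = (\<integral>\<^sup>+\<omega>. liminf (\<lambda>n. ennreal \<bar>?R n \<omega>\<bar>) \<partial>M)"
    by (rule nn_integral_cong_AE)
  also have "\<dots> \<le> liminf (\<lambda>n. \<integral>\<^sup>+\<omega>. ennreal \<bar>?R n \<omega>\<bar> \<partial>M)"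
    by (intro nn_integral_liminf measurable_compose[OF R_meas, of "\<lambda>r. ennreal \<bar>r\<bar>"]) simp
  also have "\<dots> \<le> ennreal t * c"
    by (intro Liminf_le always_eventually allI R_le) simp
  finally show ?thesis .
qed

text \<open>
  Taking the supremum in \<open>ennreal\<close> lets finiteness be propagated through sums and products without
  carrying explicit constants.
\<close>

definition moment_sup :: "'w measure \<Rightarrow> real \<Rightarrow> (real \<Rightarrow> 'w \<Rightarrow> real) \<Rightarrow> ennreal" where
  "moment_sup M T Y = (SUP s\<in>{0..T}. \<integral>\<^sup>+\<omega>. ennreal \<bar>Y s \<omega>\<bar> \<partial>M)"

lemma nn_integral_linear_combination_le:
  assumes "finite I" and meas: "\<And>i. i \<in> I \<Longrightarrow> V i \<in> borel_measurable M"
  shows "(\<integral>\<^sup>+\<omega>. ennreal \<bar>\<Sum>i\<in>I. a i * V i \<omega>\<bar> \<partial>M)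
    \<le> (\<Sum>i\<in>I. ennreal \<bar>a i\<bar> * (\<integral>\<^sup>+\<omega>. ennreal \<bar>V i \<omega>\<bar> \<partial>M))"
proof -
  have m: "(\<lambda>\<omega>. ennreal \<bar>V i \<omega>\<bar>) \<in> borel_measurable M" if "i \<in> I" for i
    using meas[OF that] by measurable
  have "ennreal \<bar>\<Sum>i\<in>I. a i * V i \<omega>\<bar> \<le> (\<Sum>i\<in>I. ennreal \<bar>a i\<bar> * ennreal \<bar>V i \<omega>\<bar>)" for \<omega>
    using sum_abs[of "\<lambda>i. a i * V i \<omega>" I]
    by (simp add: abs_mult ennreal_mult[symmetric] sum_ennreal ennreal_leI)
  then have "(\<integral>\<^sup>+\<omega>. ennreal \<bar>\<Sum>i\<in>I. a i * V i \<omega>\<bar> \<partial>M)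
      \<le> (\<integral>\<^sup>+\<omega>. (\<Sum>i\<in>I. ennreal \<bar>a i\<bar> * ennreal \<bar>V i \<omega>\<bar>) \<partial>M)"
    by (intro nn_integral_mono)
  also have "\<dots> = (\<Sum>i\<in>I. \<integral>\<^sup>+\<omega>. ennreal \<bar>a i\<bar> * ennreal \<bar>V i \<omega>\<bar> \<partial>M)"
    by (intro nn_integral_sum borel_measurable_times_ennreal borel_measurable_const m)
  also have "\<dots> = (\<Sum>i\<in>I. ennreal \<bar>a i\<bar> * (\<integral>\<^sup>+\<omega>. ennreal \<bar>V i \<omega>\<bar> \<partial>M))"
    by (intro sum.cong refl nn_integral_cmult m)
  finally show ?thesis .
qed

text \<open>
  The drift of a coordinate involves only coordinates of smaller level, so finiteness of the first
  moments follows by induction on the level, with one time integration per step.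
\<close>

lemma (in prob_space) triangular_system_moment_finite:
  fixes C :: "real ^ 'n::finite ^ 'n" and X N :: "real \<Rightarrow> 'a \<Rightarrow> real ^ 'n"
    and level :: "'n \<Rightarrow> nat"
  assumes level: "\<And>p q. C $h p $h q \<noteq> 0 \<Longrightarrow> level q < level p"
    and X_meas: "\<And>s. s \<ge> 0 \<Longrightarrow> X s \<in> borel_measurable M"
    and N_meas: "\<And>s p. s \<ge> 0 \<Longrightarrow> (\<lambda>\<omega>. N s \<omega> $h p) \<in> borel_measurable M"
    and N_fin: "\<And>p. moment_sup M T (\<lambda>s \<omega>. N s \<omega> $h p) < \<infinity>"
    and eq: "AE \<omega> in M. continuous_on {0..} (\<lambda>s. X s \<omega>) \<and> (\<forall>s\<ge>0. \<forall>p.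
      X s \<omega> $h p = x $h p + N s \<omega> $h p + integral {0..s} (\<lambda>u. (C *v X u \<omega>) $h p))"
  shows "moment_sup M T (\<lambda>s \<omega>. X s \<omega> $h p) < \<infinity>"
proof (induction "level p" arbitrary: p rule: less_induct)
  case less
  let ?c = "\<lambda>q. moment_sup M T (\<lambda>s \<omega>. X s \<omega> $h q)"
  define D where "D = (\<Sum>q\<in>UNIV. ennreal \<bar>C $h p $h q\<bar> * ?c q)"
  have comp_meas: "(\<lambda>\<omega>. X s \<omega> $h q) \<in> borel_measurable M" if "s \<ge> 0" for s q
    using X_meas[OF that] by (rule measurable_compose) simp
  have drift: "(\<integral>\<^sup>+\<omega>. ennreal \<bar>(C *v X s \<omega>) $h p\<bar> \<partial>M) \<le> D" if s: "s \<in> {0..T}" for s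
  proof -
    have "(\<integral>\<^sup>+\<omega>. ennreal \<bar>(C *v X s \<omega>) $h p\<bar> \<partial>M)
        \<le> (\<Sum>q\<in>UNIV. ennreal \<bar>C $h p $h q\<bar> * (\<integral>\<^sup>+\<omega>. ennreal \<bar>X s \<omega> $h q\<bar> \<partial>M))"
      unfolding matrix_vector_mult_def vec_lambda_beta
      by (rule nn_integral_linear_combination_le) (use s comp_meas in auto)
    also have "\<dots> \<le> D"
      unfolding D_def moment_sup_def by (intro sum_mono mult_left_mono SUP_upper s) simp
    finally show ?thesis .
  qed
  have "D < \<infinity>"
    unfolding D_def
  proof -
    have "ennreal \<bar>C $h p $h q\<bar> * ?c q < \<infinity>" for q
      using less[of q] level[of p q] by (cases "C $h p $h q = 0") (auto simp: ennreal_mult_less_top)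
    then show "(\<Sum>q\<in>UNIV. ennreal \<bar>C $h p $h q\<bar> * ?c q) < \<infinity>" by simp
  qed
  define G where "G = ennreal \<bar>x $h p\<bar> + moment_sup M T (\<lambda>s \<omega>. N s \<omega> $h p) + ennreal T * D"
  have "(\<integral>\<^sup>+\<omega>. ennreal \<bar>X s \<omega> $h p\<bar> \<partial>M) \<le> G" if s: "s \<in> {0..T}" for s
  proof -
    have "s \<ge> 0" using s by simp
    note [measurable] = comp_meas[OF \<open>s \<ge> 0\<close>] N_meas[OF \<open>s \<ge> 0\<close>]
    \<comment> \<open>almost surely the time integral of the drift, in a form whose measurability is clear\<close>
    let ?J = "\<lambda>\<omega>. X s \<omega> $h p - x $h p - N s \<omega> $h p"
    have "ennreal \<bar>X s \<omega> $h p\<bar> \<le> ennreal \<bar>x $h p\<bar> + ennreal \<bar>N s \<omega> $h p\<bar> + ennreal \<bar>?J \<omega>\<bar>" for \<omega>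
      by (simp add: ennreal_plus[symmetric] ennreal_leI del: ennreal_plus)
    then have "(\<integral>\<^sup>+\<omega>. ennreal \<bar>X s \<omega> $h p\<bar> \<partial>M)
        \<le> (\<integral>\<^sup>+\<omega>. ennreal \<bar>x $h p\<bar> + ennreal \<bar>N s \<omega> $h p\<bar> + ennreal \<bar>?J \<omega>\<bar> \<partial>M)"
      by (intro nn_integral_mono)
    also have "\<dots> = ennreal \<bar>x $h p\<bar> + (\<integral>\<^sup>+\<omega>. ennreal \<bar>N s \<omega> $h p\<bar> \<partial>M) + (\<integral>\<^sup>+\<omega>. ennreal \<bar>?J \<omega>\<bar> \<partial>M)"
      by (simp add: nn_integral_add emeasure_space_1)
    also have "(\<integral>\<^sup>+\<omega>. ennreal \<bar>?J \<omega>\<bar> \<partial>M)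
        = (\<integral>\<^sup>+\<omega>. ennreal \<bar>integral {0..s} (\<lambda>u. (C *v X u \<omega>) $h p)\<bar> \<partial>M)"
      using eq \<open>s \<ge> 0\<close> by (intro nn_integral_cong_AE) auto
    also have "\<dots> \<le> ennreal s * D"
    proof (rule nn_integral_time_integral_le)
      show "(\<lambda>\<omega>. (C *v X u \<omega>) $h p) \<in> borel_measurable M" if "u \<in> {0..s}" for u
        unfolding matrix_vector_mult_def vec_lambda_beta using that
        by (intro borel_measurable_sum borel_measurable_times borel_measurable_const comp_meas) simp
      show "AE \<omega> in M. continuous_on {0..s} (\<lambda>u. (C *v X u \<omega>) $h p)"
        using eq
      proof eventually_elim
        case (elim \<omega>)
        then have "continuous_on {0..s} (\<lambda>u. X u \<omega>)"
          using continuous_on_subset[of "{0..}" _ "{0..s}"] by auto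
        then show ?case
          by (intro continuous_on_component
              bounded_linear.continuous_on[OF matrix_vector_mul_bounded_linear])
      qed
    qed (use s drift in auto)
    also have "ennreal s * D \<le> ennreal T * D"
      using s by (intro mult_right_mono ennreal_leI) auto
    also have "(\<integral>\<^sup>+\<omega>. ennreal \<bar>N s \<omega> $h p\<bar> \<partial>M) \<le> moment_sup M T (\<lambda>s \<omega>. N s \<omega> $h p)"
      unfolding moment_sup_def using s by (rule SUP_upper)
    finally show ?thesis by (simp add: G_def add_mono)
  qed
  then have "moment_sup M T (\<lambda>s \<omega>. X s \<omega> $h p) \<le> G"
    unfolding moment_sup_def by (rule SUP_least)
  also have "G < \<infinity>"
    using \<open>D < \<infinity>\<close> N_fin[of p] by (simp add: G_def ennreal_mult_less_top)
  finally show ?case .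
qed

text \<open>
  The Gaussian law is available for increments only, so \<open>W s\<close> is compared with \<open>W s - W 0\<close>; the
  constant is the first absolute moment of the centred normal law with variance \<open>T\<close>.
\<close>

lemma brownian_moment_finite:
  assumes W: "standard_brownian_motion d M W" and i: "i < d"
  shows "moment_sup M T (\<lambda>s \<omega>. W s \<omega> $ i) < \<infinity>"
proof -
  have "(\<integral>\<^sup>+\<omega>. ennreal \<bar>W s \<omega> $ i\<bar> \<partial>M) \<le> ennreal (sqrt T * sqrt (2 / pi))" if s: "s \<in> {0..T}" for s
  proof -
    have W0: "AE \<omega> in M. W 0 \<omega> = 0\<^sub>v d"
      using W by (simp add: standard_brownian_motion_def)
    show ?thesis
    proof (cases "s = 0")
      case True
      have "(\<integral>\<^sup>+\<omega>. ennreal \<bar>W 0 \<omega> $ i\<bar> \<partial>M) = (\<integral>\<^sup>+\<omega>. 0 \<partial>M)"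
        using W0 i by (intro nn_integral_cong_AE) auto
      then show ?thesis using True by simp
    next
      case False
      then have "s > 0" using s by simp
      then have D: "distributed M lborel (\<lambda>\<omega>. W s \<omega> $ i - W 0 \<omega> $ i) (normal_density 0 (sqrt s))"
      proof -
        have "\<forall>s t. 0 \<le> s \<longrightarrow> s < t \<longrightarrow> (\<forall>i<d. distributed M lborel
            (\<lambda>\<omega>. W t \<omega> $ i - W s \<omega> $ i) (normal_density 0 (sqrt (t - s))))"
          using W unfolding standard_brownian_motion_def by blast
        from this[rule_format, of 0 s i] show ?thesis
          using \<open>s > 0\<close> i by simp
      qed
      have "(\<integral>\<^sup>+\<omega>. ennreal \<bar>W s \<omega> $ i\<bar> \<partial>M) = (\<integral>\<^sup>+\<omega>. ennreal \<bar>W s \<omega> $ i - W 0 \<omega> $ i\<bar> \<partial>M)"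
        using W0 i by (intro nn_integral_cong_AE) auto
      also have "\<dots> = (\<integral>\<^sup>+u. ennreal (normal_density 0 (sqrt s) u) * ennreal \<bar>u\<bar> \<partial>lborel)"
        by (rule distributed_nn_integral[OF D, symmetric]) simp
      \<comment> \<open>the exponent 1 as the case 0 of the formula for odd absolute moments\<close>
      also have "\<dots> = (\<integral>\<^sup>+u. ennreal (normal_density 0 (sqrt s) u * \<bar>u - 0\<bar> ^ (2 * 0 + 1)) \<partial>lborel)"
        by (simp add: ennreal_mult)
      also have "\<dots> = ennreal (sqrt s * sqrt (2 / pi))"
        using normal_moment_abs_odd[of "sqrt s" 0 0] \<open>s > 0\<close>
        by (subst nn_integral_eq_integral) (auto simp: has_bochner_integral_iff)
      also have "\<dots> \<le> ennreal (sqrt T * sqrt (2 / pi))"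
        using s by (intro ennreal_leI mult_right_mono) auto
      finally show ?thesis .
    qed
  qed
  then have "moment_sup M T (\<lambda>s \<omega>. W s \<omega> $ i) \<le> ennreal (sqrt T * sqrt (2 / pi))"
    unfolding moment_sup_def by (rule SUP_least)
  then show ?thesis using ennreal_less_top le_less_trans by (metis infinity_ennreal_def)
qed

lemma noise_eq_sum:
  assumes bl: "block_labelling r m idx" and \<sigma>: "\<sigma> \<in> carrier_mat (m 0) (m 0)"
    and W: "W s \<omega> \<in> carrier_vec (m 0)"
  shows "noise \<sigma> idx W s \<omega> $h p
    = (\<Sum>j<m 0. (if fst (idx p) = 0 then \<sigma> $$ (snd (idx p), j) else 0) * W s \<omega> $ j)"
  using block_coordinate(2)[OF bl, of p] \<sigma> W
  by (auto simp: noise_def scalar_prod_def atLeast0LessThan)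

lemma noise_measurable_moment_finite:
  assumes bl: "block_labelling r m idx" and \<sigma>: "\<sigma> \<in> carrier_mat (m 0) (m 0)"
    and W: "standard_brownian_motion (m 0) M W"
  shows "s \<ge> 0 \<Longrightarrow> (\<lambda>\<omega>. noise \<sigma> idx W s \<omega> $h p) \<in> borel_measurable M"
    and "moment_sup M T (\<lambda>s \<omega>. noise \<sigma> idx W s \<omega> $h p) < \<infinity>"
proof -
  have carrier: "\<forall>t\<ge>0. \<forall>\<omega>\<in>space M. W t \<omega> \<in> carrier_vec (m 0)"
    and meas: "\<forall>t\<ge>0. \<forall>i<m 0. (\<lambda>\<omega>. W t \<omega> $ i) \<in> borel_measurable M"
    using W unfolding standard_brownian_motion_def by blast+
  define a where "a j = (if fst (idx p) = 0 then \<sigma> $$ (snd (idx p), j) else 0)" for j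
  have eq: "noise \<sigma> idx W s \<omega> $h p = (\<Sum>j<m 0. a j * W s \<omega> $ j)" if "s \<ge> 0" "\<omega> \<in> space M" for s \<omega>
    unfolding a_def using carrier that by (intro noise_eq_sum[OF bl \<sigma>]) simp
  show "(\<lambda>\<omega>. noise \<sigma> idx W s \<omega> $h p) \<in> borel_measurable M" if "s \<ge> 0"
  proof -
    have "(\<lambda>\<omega>. \<Sum>j<m 0. a j * W s \<omega> $ j) \<in> borel_measurable M"
      by (intro borel_measurable_sum borel_measurable_times borel_measurable_const)
        (use meas that in auto)
    then show ?thesis using eq[OF that] by (simp cong: measurable_cong)
  qed
  define D where "D = (\<Sum>j<m 0. ennreal \<bar>a j\<bar> * moment_sup M T (\<lambda>s \<omega>. W s \<omega> $ j))"
  have "(\<integral>\<^sup>+\<omega>. ennreal \<bar>noise \<sigma> idx W s \<omega> $h p\<bar> \<partial>M) \<le> D" if s: "s \<in> {0..T}" for s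
  proof -
    have "(\<integral>\<^sup>+\<omega>. ennreal \<bar>noise \<sigma> idx W s \<omega> $h p\<bar> \<partial>M)
        = (\<integral>\<^sup>+\<omega>. ennreal \<bar>\<Sum>j<m 0. a j * W s \<omega> $ j\<bar> \<partial>M)"
      using eq[of s] s by (intro nn_integral_cong) auto
    also have "\<dots> \<le> (\<Sum>j<m 0. ennreal \<bar>a j\<bar> * (\<integral>\<^sup>+\<omega>. ennreal \<bar>W s \<omega> $ j\<bar> \<partial>M))"
      by (rule nn_integral_linear_combination_le) (use meas s in auto)
    also have "\<dots> \<le> D"
      unfolding D_def moment_sup_def by (intro sum_mono mult_left_mono SUP_upper s) simp
    finally show ?thesis .
  qed
  then have "moment_sup M T (\<lambda>s \<omega>. noise \<sigma> idx W s \<omega> $h p) \<le> D"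
    unfolding moment_sup_def by (rule SUP_least)
  also have "D < \<infinity>"
    using brownian_moment_finite[OF W] by (auto simp: D_def ennreal_mult_less_top)
  finally show "moment_sup M T (\<lambda>s \<omega>. noise \<sigma> idx W s \<omega> $h p) < \<infinity>" .
qed

text \<open>
  The level of a coordinate is the number of its block, since \<open>B\<^sup>T\<close> maps each block to the next one.
\<close>

lemma diffusion_integrable:
  assumes bl: "block_labelling r m idx" and \<sigma>: "\<sigma> \<in> carrier_mat (m 0) (m 0)"
    and B: "\<forall>k\<in>{1..r}. B k \<in> carrier_mat (m (k - 1)) (m k)"
    and W: "standard_brownian_motion (m 0) M W"
    and X: "diffusion_from r m \<sigma> B idx M W x X" and "t \<ge> 0"
  shows "integrable M (X t)"
proof -
  interpret prob_space M using W by (simp add: standard_brownian_motion_def)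
  let ?C = "Finite_Cartesian_Product.transpose (big_B idx B)"
  have X_meas: "X s \<in> borel_measurable M" if "s \<ge> 0" for s
    using X that by (simp add: diffusion_from_def)
  have comp: "integrable M (\<lambda>\<omega>. X t \<omega> $h p)" for p
  proof (rule integrableI_bounded)
    show "(\<lambda>\<omega>. X t \<omega> $h p) \<in> borel_measurable M"
      using X_meas[OF \<open>t \<ge> 0\<close>] by (rule measurable_compose) simp
    have "?C $h p $h q \<noteq> 0 \<Longrightarrow> fst (idx q) < fst (idx p)" for p q
      by (auto simp: Finite_Cartesian_Product.transpose_def big_B_def split: if_splits)
    then have "moment_sup M t (\<lambda>s \<omega>. X s \<omega> $h p) < \<infinity>"
      using X_meas noise_measurable_moment_finite[OF bl \<sigma> W] diffusion_path_equation[OF bl \<sigma> B X]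
      by (rule triangular_system_moment_finite)
    moreover have "(\<integral>\<^sup>+\<omega>. ennreal \<bar>X t \<omega> $h p\<bar> \<partial>M) \<le> moment_sup M t (\<lambda>s \<omega>. X s \<omega> $h p)"
      unfolding moment_sup_def using \<open>t \<ge> 0\<close> by (intro SUP_upper) simp
    ultimately show "(\<integral>\<^sup>+\<omega>. ennreal (norm (X t \<omega> $h p)) \<partial>M) < \<infinity>" by simp
  qed
  show ?thesis
  proof (rule Bochner_Integration.integrable_bound)
    show "integrable M (\<lambda>\<omega>. \<Sum>p\<in>UNIV. \<bar>X t \<omega> $h p\<bar>)"
      using comp by simp
    show "X t \<in> borel_measurable M" by (rule X_meas) fact
    show "AE \<omega> in M. norm (X t \<omega>) \<le> norm (\<Sum>p\<in>UNIV. \<bar>X t \<omega> $h p\<bar>)"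
      using norm_le_l1_cart by (auto simp: sum_nonneg)
  qed
qed

section \<open>The gradient bounds\<close>

theorem corollary2p7:
  fixes r :: nat and m :: "nat \<Rightarrow> nat"
    and \<sigma> A0 :: "real mat" and B :: "nat \<Rightarrow> real mat"
    and idx :: "'n::finite \<Rightarrow> nat \<times> nat"
    and M :: "'w measure" and W :: "real \<Rightarrow> 'w \<Rightarrow> real Matrix.vec"
    and X :: "real ^ 'n \<Rightarrow> real \<Rightarrow> 'w \<Rightarrow> real ^ 'n"
    and f :: "real ^ 'n \<Rightarrow> real" and t :: real and x :: "real ^ 'n"
  assumes "r \<ge> 1"
    and "\<forall>k<r. m (Suc k) \<le> m k" and "m r \<ge> 1"
    and "block_labelling r m idx"
    and "\<sigma> \<in> carrier_mat (m 0) (m 0)" and "A0 = \<sigma> * transpose_mat \<sigma>"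
    and "\<forall>k\<in>{1..r}. B k \<in> carrier_mat (m (k - 1)) (m k)"
    and "\<forall>k\<in>{1..r}. vec_space.rank (m (k - 1)) (B k) = m k"
    and "standard_brownian_motion (m 0) M W"
    and "\<forall>y. diffusion_from r m \<sigma> B idx M W y (X y)"
    and "C1 f" and "\<exists>L. L-lipschitz_on UNIV f"
    and "t \<ge> 0"
  shows "integrable M (\<lambda>\<omega>. f (X x t \<omega>))
    \<and> Pt M X t f differentiable (at x)
    \<and> 2 * Gamma (big_A idx A0) (Pt M X t f) x
        \<le> Pt M X t (\<lambda>y. inner
            ((E_mat idx B (- t) ** big_A idx A0 ** Finite_Cartesian_Product.transpose (E_mat idx B (- t)))
               *v grad f y) (grad f y)) x
    \<and> inner
        ((E_mat idx B t ** big_A idx A0 ** Finite_Cartesian_Product.transpose (E_mat idx B t))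
           *v grad (Pt M X t f) x) (grad (Pt M X t f) x)
        \<le> 2 * Pt M X t (Gamma (big_A idx A0) f) x"
proof -
  define C where "C = Finite_Cartesian_Product.transpose (big_B idx B)"
  define E where "E = E_mat idx B (- t)"
  define E' where "E' = E_mat idx B t"
  define A where "A = big_A idx A0"
  define S where "S = big_A idx \<sigma>"
  interpret prob_space M
    using assms(9) by (simp add: standard_brownian_motion_def)
  obtain L where L: "L-lipschitz_on UNIV f" using assms(12) by blast
  note C1 = C1_lipschitz_grad[OF \<open>C1 f\<close> L]
  have E: "E = mat_exp (t *\<^sub>R C)" and E': "E' = mat_exp (- t *\<^sub>R C)"
    by (simp_all add: E_def E'_def E_mat_def C_def)
  have A: "A = S ** Finite_Cartesian_Product.transpose S"
    unfolding A_def S_def assms(6) by (rule big_A_factor[OF assms(4,5)])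
  have X_meas: "X y t \<in> borel_measurable M" for y
    using assms(10,13) by (simp add: diffusion_from_def)
  have f_int: "integrable M (\<lambda>\<omega>. f (X y t \<omega>))" for y
    by (rule integrable_lipschitz_compose[OF _ L], rule diffusion_integrable[OF assms(4,5,7,9)])
      (use assms(10,13) in auto)
  have flow: "AE \<omega> in M. X y t \<omega> = X x t \<omega> + E *v (y - x)" for y
  proof -
    have "AE \<omega> in M. continuous_on {0..} (\<lambda>s. X z s \<omega>) \<and>
      (\<forall>s\<ge>0. \<forall>p. X z s \<omega> $h p = z $h p + noise \<sigma> idx W s \<omega> $h p +
        integral {0..s} (\<lambda>u. (C *v X z u \<omega>) $h p))" for z
      unfolding C_def
      by (rule diffusion_path_equation[OF assms(4,5,7)]) (use assms(10) in blast)
    from this[of x] this[of y] show ?thesis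
    proof eventually_elim
      case (elim \<omega>)
      then show ?case
        unfolding E
        by (intro linear_equation_flow[where n = "\<lambda>s. noise \<sigma> idx W s \<omega>"] \<open>t \<ge> 0\<close>) auto
    qed
  qed
  define G where "G = (\<integral>\<omega>. grad f (X x t \<omega>) \<partial>M)"
  have "Pt M X t f y = (\<integral>\<omega>. f (X x t \<omega> + E *v (y - x)) \<partial>M)" for y
    unfolding Pt_def
    by (rule integral_cong_AE)
      (use flow[of y] f_int[of y] integrable_lipschitz_shift[OF X_meas f_int L] in \<open>auto elim: eventually_mono\<close>)
  then have "Pt M X t f = (\<lambda>y. \<integral>\<omega>. f (X x t \<omega> + E *v (y - x)) \<partial>M)" ..
  then have deriv: "(Pt M X t f has_derivative (\<lambda>h. inner (E *v h) G)) (at x)"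
    unfolding G_def
    using expectation_shift_has_derivative[OF X_meas f_int \<open>C1 f\<close> L matrix_vector_mul_bounded_linear]
    by simp
  then have diff: "Pt M X t f differentiable (at x)"
    by (auto simp: differentiable_def)
  have "inner (E *v h) G = inner h (Finite_Cartesian_Product.transpose E *v G)" for h
    by (metis dot_lmul_matrix inner_commute transpose_matrix_vector)
  with deriv have grad_Pt: "grad (Pt M X t f) x = Finite_Cartesian_Product.transpose E *v G"
    by (intro grad_eqI) (simp add: gderiv_def)
  have u: "(\<lambda>\<omega>. grad f (X x t \<omega>)) \<in> borel_measurable M" "\<And>\<omega>. norm (grad f (X x t \<omega>)) \<le> L"
    using measurable_compose[OF X_meas C1(3)] C1(2) by auto
  have fwd: "2 * Gamma A (Pt M X t f) x \<le> Pt M X t (\<lambda>y. inner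
      ((E ** A ** Finite_Cartesian_Product.transpose E) *v grad f y) (grad f y)) x"
  proof -
    have "E ** A ** Finite_Cartesian_Product.transpose E
        = (E ** S) ** Finite_Cartesian_Product.transpose (E ** S)"
      by (simp add: A matrix_transpose_mul matrix_mul_assoc)
    from quadratic_form_expectation_le[OF u this] show ?thesis
      by (simp add: Gamma_def grad_Pt Pt_def G_def quadratic_form_congruence)
  qed
  have rev: "inner ((E' ** A ** Finite_Cartesian_Product.transpose E') *v grad (Pt M X t f) x)
      (grad (Pt M X t f) x) \<le> 2 * Pt M X t (Gamma A f) x"
  proof -
    \<comment> \<open>the factor of the reverse form undoes the factor in the gradient of the semigroup\<close>
    have "E ** E' = Finite_Cartesian_Product.mat 1"
      unfolding E E' using mat_exp_inverse[of "- t" C] by simp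
    moreover have "Finite_Cartesian_Product.transpose E' *v grad (Pt M X t f) x
        = Finite_Cartesian_Product.transpose (E ** E') *v G"
      by (simp only: grad_Pt matrix_vector_mul_assoc matrix_transpose_mul)
    ultimately have "Finite_Cartesian_Product.transpose E' *v grad (Pt M X t f) x = G"
      by (simp only: transpose_mat matrix_vector_mul_lid)
    then have "inner ((E' ** A ** Finite_Cartesian_Product.transpose E') *v grad (Pt M X t f) x)
      (grad (Pt M X t f) x) = inner (A *v G) G"
      by (simp only: quadratic_form_congruence)
    also have "\<dots> \<le> (\<integral>\<omega>. inner (A *v grad f (X x t \<omega>)) (grad f (X x t \<omega>)) \<partial>M)"
      unfolding G_def by (rule quadratic_form_expectation_le[OF u A])
    also have "\<dots> = 2 * Pt M X t (Gamma A f) x"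
      by (simp add: Pt_def Gamma_def)
    finally show ?thesis .
  qed
  show ?thesis
    using f_int diff fwd rev unfolding E_def E'_def A_def by blast
qed

end
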